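(* Let $M$ be a connected orientable hypersurface of $\mathbb{H}^2\times\mathbb{H}^2$. If $M$ has at most two distinct principal curvatures, all constant, then, up to an isometry of $\mathbb{H}^2\times\mathbb{H}^2$, $M$ is either an open part of $M_\Gamma$, where $\Gamma$ is a curve of $\mathbb{H}^2$ with constant curvature, or an open part of $M^{1/2}_{1,-1}$.
   Context: $\mathbb{R}^3_1$ denotes $\mathbb{R}^3$ with the Lorentzian inner product $\langle x,y\rangle=-x_1y_1+x_2y_2+x_3y_3$, and $\mathbb{H}^2=\{x\in\mathbb{R}^3_1:\langle x,x\rangle=-1,\ x_1>0\}$. $\mathbb{H}^2\times\mathbb{H}^2$ carries the Riemannian product metric. For a smooth curve $\Gamma\subset\mathbb{H}^2$, $M_\Gamma=\{(x,y): x\in\Gamma,\ y\in\mathbb{H}^2\}$. With $\gamma(r)=(\tfrac{2+r^2}{2},r,\tfrac{r^2}{2})$, $N(r)=(-\tfrac{r^2}{2},-r,\tfrac{2-r^2}{2})$ and $\tilde N(s)=(\tfrac{s^2}{2},s,\tfrac{s^2-2}{2})$, $M^{1/2}_{1,-1}$ is the image of $(t,r,s)\mapsto\big(\cosh(t/\sqrt2)\gamma(r)+\sinh(t/\sqrt2)N(r),\ \cosh(t/\sqrt2)\gamma(s)+\sinh(t/\sqrt2)\tilde N(s)\big)$. *)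

theory Defs
  imports "HOL-Analysis.Analysis"
begin

definition lor :: "real^3 \<Rightarrow> real^3 \<Rightarrow> real" where
  "lor x y = - x$1 * y$1 + x$2 * y$2 + x$3 * y$3"

definition H2 :: "(real^3) set" where
  "H2 = {x. lor x x = -1 \<and> x$1 > 0}"

type_synonym pt = "(real^3) \<times> (real^3)"

text \<open>Ambient bilinear form on R^3_1 x R^3_1; restricted to tangent spaces of
  H^2 x H^2 it is the Riemannian product metric.\<close>
definition G :: "pt \<Rightarrow> pt \<Rightarrow> real" where
  "G p q = lor (fst p) (fst q) + lor (snd p) (snd q)"

definition HH :: "pt set" where
  "HH = H2 \<times> H2"

definition tangent_HH :: "pt \<Rightarrow> pt set" where
  "tangent_HH p = {v. lor (fst p) (fst v) = 0 \<and> lor (snd p) (snd v) = 0}"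

coinductive Cinf_on :: "'a::euclidean_space set \<Rightarrow> ('a \<Rightarrow> 'b::real_normed_vector) \<Rightarrow> bool"
  for U where
  "\<lbrakk>f differentiable_on U; \<forall>v. Cinf_on U (\<lambda>x. frechet_derivative f (at x) v)\<rbrakk>
     \<Longrightarrow> Cinf_on U f"

definition chart :: "pt set \<Rightarrow> (real^3) set \<Rightarrow> (real^3 \<Rightarrow> pt) \<Rightarrow> bool" where
  "chart M U f \<longleftrightarrow> open U \<and> Cinf_on U f \<and> f ` U \<subseteq> M
     \<and> openin (top_of_set M) (f ` U)
     \<and> (\<exists>g. homeomorphism U (f ` U) f g)
     \<and> (\<forall>u\<in>U. inj (frechet_derivative f (at u)))"

definition hypersurface :: "pt set \<Rightarrow> bool" where
  "hypersurface M \<longleftrightarrow> M \<subseteq> HH \<and> (\<forall>p\<in>M. \<exists>U f. chart M U f \<and> p \<in> f ` U)"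

definition unit_normal :: "pt set \<Rightarrow> (pt \<Rightarrow> pt) \<Rightarrow> bool" where
  "unit_normal M \<xi> \<longleftrightarrow>
     (\<forall>p\<in>M. \<xi> p \<in> tangent_HH p \<and> G (\<xi> p) (\<xi> p) = 1)
     \<and> (\<forall>U f. chart M U f \<longrightarrow> Cinf_on U (\<xi> \<circ> f)
          \<and> (\<forall>u\<in>U. \<forall>v. G (\<xi> (f u)) (frechet_derivative f (at u) v) = 0))"

definition orientable :: "pt set \<Rightarrow> bool" where
  "orientable M \<longleftrightarrow> (\<exists>\<xi>. unit_normal M \<xi>)"

text \<open>First fundamental form, second fundamental form and shape operator
  (Weingarten map) in the coordinates of a chart f at parameter u.
  h_ij = g(A f_i, f_j) = - <nabla_{f_i} xi, f_j> = - G(d(xi o f)(e_i), f_j),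
  since the normal part of the ambient derivative is G-orthogonal to TM.\<close>
definition first_ff :: "(real^3 \<Rightarrow> pt) \<Rightarrow> real^3 \<Rightarrow> real^3^3" where
  "first_ff f u = (\<chi> i j. G (frechet_derivative f (at u) (axis i 1))
                            (frechet_derivative f (at u) (axis j 1)))"

definition second_ff :: "(pt \<Rightarrow> pt) \<Rightarrow> (real^3 \<Rightarrow> pt) \<Rightarrow> real^3 \<Rightarrow> real^3^3" where
  "second_ff \<xi> f u = (\<chi> i j. - G (frechet_derivative (\<xi> \<circ> f) (at u) (axis i 1))
                                (frechet_derivative f (at u) (axis j 1)))"

definition shape_matrix :: "(pt \<Rightarrow> pt) \<Rightarrow> (real^3 \<Rightarrow> pt) \<Rightarrow> real^3 \<Rightarrow> real^3^3" where
  "shape_matrix \<xi> f u = matrix_inv (first_ff f u) ** second_ff \<xi> f u"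

definition principal_curvatures_const ::
    "pt set \<Rightarrow> (pt \<Rightarrow> pt) \<Rightarrow> real \<Rightarrow> real \<Rightarrow> real \<Rightarrow> bool" where
  "principal_curvatures_const M \<xi> k1 k2 k3 \<longleftrightarrow>
     (\<forall>U f. chart M U f \<longrightarrow> (\<forall>u\<in>U. \<forall>x::real.
        det (mat x - shape_matrix \<xi> f u) = (x - k1) * (x - k2) * (x - k3)))"

definition isometry_HH :: "(pt \<Rightarrow> pt) \<Rightarrow> bool" where
  "isometry_HH \<Phi> \<longleftrightarrow> bij_betw \<Phi> HH HH
     \<and> (\<exists>W. open W \<and> HH \<subseteq> W \<and> Cinf_on W \<Phi>)
     \<and> (\<forall>p\<in>HH. \<forall>v\<in>tangent_HH p. \<forall>w\<in>tangent_HH p.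
          G (frechet_derivative \<Phi> (at p) v) (frechet_derivative \<Phi> (at p) w) = G v w)"

text \<open>Gamma is a curve of H^2 with constant (geodesic) curvature kappa: the image
  of an open interval under a smooth unit-speed curve c in H^2 with
  nabla_{c'} c' = c'' - c = kappa nu, nu a continuous unit normal along c.\<close>
definition const_curv_curve :: "(real^3) set \<Rightarrow> bool" where
  "const_curv_curve \<Gamma> \<longleftrightarrow> (\<exists>I c \<nu> \<kappa>. open I \<and> is_interval I \<and> I \<noteq> {}
     \<and> \<Gamma> = c ` I \<and> Cinf_on I c \<and> continuous_on I \<nu>
     \<and> (\<forall>t\<in>I. c t \<in> H2
          \<and> lor (vector_derivative c (at t)) (vector_derivative c (at t)) = 1
          \<and> lor (c t) (\<nu> t) = 0 \<and> lor (vector_derivative c (at t)) (\<nu> t) = 0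
          \<and> lor (\<nu> t) (\<nu> t) = 1
          \<and> vector_derivative (\<lambda>s. vector_derivative c (at s)) (at t) - c t
              = \<kappa> *\<^sub>R \<nu> t))"

definition M_Gamma :: "(real^3) set \<Rightarrow> pt set" where
  "M_Gamma \<Gamma> = {(x, y). x \<in> \<Gamma> \<and> y \<in> H2}"

definition gam :: "real \<Rightarrow> real^3" where
  "gam r = vector [(2 + r^2) / 2, r, r^2 / 2]"

definition Nv :: "real \<Rightarrow> real^3" where
  "Nv r = vector [- (r^2) / 2, - r, (2 - r^2) / 2]"

definition Ntil :: "real \<Rightarrow> real^3" where
  "Ntil s = vector [s^2 / 2, s, (s^2 - 2) / 2]"

definition M_half :: "pt set" where
  "M_half = (\<lambda>(t, r, s).
      (cosh (t / sqrt 2) *\<^sub>R gam r + sinh (t / sqrt 2) *\<^sub>R Nv r,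
       cosh (t / sqrt 2) *\<^sub>R gam s + sinh (t / sqrt 2) *\<^sub>R Ntil s)) ` UNIV"

end

theory Submission
  imports Defs
begin

text \<open>
  Write the unit normal as \<open>n = (n\<^sub>1, n\<^sub>2)\<close> along a chart \<open>f = (f\<^sub>1, f\<^sub>2)\<close>, with curvatures \<open>a, b, b\<close>, and put
  \<open>p = |n\<^sub>1|\<^sup>2\<close>, \<open>q = |n\<^sub>2|\<^sup>2 = 1 - p\<close> and \<open>\<tau>(X) = \<langle>n\<^sub>1, f\<^sub>1\<^sub>X\<rangle> = - \<langle>n\<^sub>2, f\<^sub>2\<^sub>X\<rangle>\<close>. The form
  \<open>\<beta> = h - b g\<close> has rank at most one and constant sign, so on a vector of its kernel it is extremal and
  its derivative vanishes; commuting second derivatives of \<open>n\<close> then yield the Codazzi relation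
  \<open>\<tau>(X) \<langle>PY, Z\<rangle> = \<tau>(Z) \<langle>PY, X\<rangle>\<close> for \<open>X, Y, Z\<close> in the kernel, where \<open>P(v\<^sub>1, v\<^sub>2) = (v\<^sub>1, - v\<^sub>2)\<close>.
  Where \<open>p, q \<noteq> 0\<close> this leaves two possible directions for the image of \<open>\<beta>\<close>. Differentiating once more
  excludes one of them, and the other one forces \<open>p = q = 1/2\<close>, \<open>a = 0\<close> and \<open>2 b\<^sup>2 = 1\<close>.

  Hence \<open>p\<close> is constantly \<open>0\<close>, \<open>1/2\<close> or \<open>1\<close>. If \<open>p = 1\<close>, then \<open>n\<^sub>1 + \<kappa> f\<^sub>1\<close> is a constant vector \<open>c\<close>, where
  \<open>\<kappa>\<close> is the trace of the shape operator, so \<open>f\<^sub>1\<close> runs in the curve \<open>\<langle>x, c\<rangle> = - \<kappa>\<close> of constant curvature;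
  \<open>p = 0\<close> is the mirror image. If \<open>p = 1/2\<close>, the null vectors \<open>\<nu>\<^sub>i = f\<^sub>i + 2 b n\<^sub>i\<close> satisfy
  \<open>d\<nu>\<^sub>1 = 2 b \<tau> \<nu>\<^sub>1\<close> and \<open>d\<nu>\<^sub>2 = - 2 b \<tau> \<nu>\<^sub>2\<close>, so \<open>\<nu>\<^sub>1 \<otimes> \<nu>\<^sub>2\<close> is constant and the hypersurface lies in
  \<open>\<langle>x, c\<^sub>1\<rangle> \<langle>y, c\<^sub>2\<rangle> = 1\<close> for two null vectors, which a Lorentz transformation in each factor moves to \<open>M_half\<close>.
  Openness follows from invariance of domain.
\<close>

section \<open>Smooth maps and symmetry of second derivatives\<close>

text \<open>Every structure equation below (tangency, unit length, normality and what follows from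
  them) arises this way: the product rule, applied to an expression that is constant on the open
  domain, must give zero.\<close>

lemma has_derivative_zero_on_open:
  fixes \<phi> :: "'a::real_normed_vector \<Rightarrow> 'b::real_normed_vector"
  assumes "open U" "u \<in> U" "\<And>x. x \<in> U \<Longrightarrow> \<phi> x = c" "(\<phi> has_derivative \<phi>') (at u)"
  shows "\<phi>' X = 0"
proof -
  have "((\<lambda>_. c) has_derivative \<phi>') (at u)"
    by (rule has_derivative_transform_within_open[OF assms(4,1,2)]) (rule assms(3))
  then have "\<phi>' = (\<lambda>_. 0)"
    using has_derivative_const by (rule has_derivative_unique)
  then show ?thesis by simp
qed

text \<open>Mean value theorem applied twice to the second difference over the parallelogram with
  sides \<open>s *\<^sub>R X\<close> and \<open>s *\<^sub>R Z\<close>, first along X and then along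
  Z.\<close>

lemma second_difference_mvt:
  fixes g :: "'a::real_normed_vector \<Rightarrow> real"
  assumes s: "s > 0"
    and sub: "\<And>r t. 0 \<le> r \<Longrightarrow> r \<le> s \<Longrightarrow> 0 \<le> t \<Longrightarrow> t \<le> s \<Longrightarrow> u + r *\<^sub>R X + t *\<^sub>R Z \<in> U"
    and g: "\<And>x. x \<in> U \<Longrightarrow> (g has_derivative g' x) (at x)"
    and g': "\<And>x. x \<in> U \<Longrightarrow> ((\<lambda>x. g' x X) has_derivative g'' x) (at x)"
  shows "\<exists>r t. 0 \<le> r \<and> r \<le> s \<and> 0 \<le> t \<and> t \<le> s \<and>
    g (u + s *\<^sub>R X + s *\<^sub>R Z) - g (u + s *\<^sub>R X) - g (u + s *\<^sub>R Z) + g u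
      = s^2 * g'' (u + r *\<^sub>R X + t *\<^sub>R Z) Z"
proof -
  define \<psi> where "\<psi> r = g (u + r *\<^sub>R X + s *\<^sub>R Z) - g (u + r *\<^sub>R X)" for r
  have line: "((\<lambda>r. g (u + r *\<^sub>R X + t *\<^sub>R Z)) has_real_derivative g' (u + r *\<^sub>R X + t *\<^sub>R Z) X) (at r)"
    if "0 \<le> r" "r \<le> s" "0 \<le> t" "t \<le> s" for r t
  proof -
    have lin: "linear (g' (u + r *\<^sub>R X + t *\<^sub>R Z))"
      using g[OF sub[OF that]] has_derivative_linear by blast
    have i: "((\<lambda>r. u + r *\<^sub>R X + t *\<^sub>R Z) has_derivative (\<lambda>h. h *\<^sub>R X)) (at r)"
      by (auto intro!: derivative_eq_intros)
    have "((\<lambda>r. g (u + r *\<^sub>R X + t *\<^sub>R Z)) has_derivative (\<lambda>h. g' (u + r *\<^sub>R X + t *\<^sub>R Z) (h *\<^sub>R X))) (at r)"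
      by (rule has_derivative_compose[OF i g[OF sub[OF that]]])
    then show ?thesis
      by (simp add: has_field_derivative_def linear_scale[OF lin] mult.commute[of _ "g' _ _"])
  qed
  have \<psi>': "(\<psi> has_real_derivative g' (u + r *\<^sub>R X + s *\<^sub>R Z) X - g' (u + r *\<^sub>R X) X) (at r)"
    if "0 \<le> r" "r \<le> s" for r
    unfolding \<psi>_def
    using DERIV_diff[OF line[of r s] line[of r 0]] that s by simp
  obtain r where r: "0 < r" "r < s" and
    1: "\<psi> s - \<psi> 0 = (s - 0) * (g' (u + r *\<^sub>R X + s *\<^sub>R Z) X - g' (u + r *\<^sub>R X) X)"
    using MVT2[OF s, of \<psi> "\<lambda>r. g' (u + r *\<^sub>R X + s *\<^sub>R Z) X - g' (u + r *\<^sub>R X) X"] \<psi>' by blast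
  have line2: "((\<lambda>t. g' (u + r *\<^sub>R X + t *\<^sub>R Z) X) has_real_derivative g'' (u + r *\<^sub>R X + t *\<^sub>R Z) Z) (at t)"
    if "0 \<le> t" "t \<le> s" for t
  proof -
    have m: "u + r *\<^sub>R X + t *\<^sub>R Z \<in> U" using sub r that by simp
    have lin: "linear (g'' (u + r *\<^sub>R X + t *\<^sub>R Z))"
      using g'[OF m] has_derivative_linear by blast
    have i: "((\<lambda>t. u + r *\<^sub>R X + t *\<^sub>R Z) has_derivative (\<lambda>h. h *\<^sub>R Z)) (at t)"
      by (auto intro!: derivative_eq_intros)
    have "((\<lambda>t. g' (u + r *\<^sub>R X + t *\<^sub>R Z) X) has_derivative (\<lambda>h. g'' (u + r *\<^sub>R X + t *\<^sub>R Z) (h *\<^sub>R Z))) (at t)"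
      by (rule has_derivative_compose[OF i g'[OF m]])
    then show ?thesis
      by (simp add: has_field_derivative_def linear_scale[OF lin] mult.commute[of _ "g'' _ _"])
  qed
  obtain t where t: "0 < t" "t < s" and
    2: "g' (u + r *\<^sub>R X + s *\<^sub>R Z) X - g' (u + r *\<^sub>R X + 0 *\<^sub>R Z) X = (s - 0) * g'' (u + r *\<^sub>R X + t *\<^sub>R Z) Z"
    using MVT2[OF s, of "\<lambda>t. g' (u + r *\<^sub>R X + t *\<^sub>R Z) X" "\<lambda>t. g'' (u + r *\<^sub>R X + t *\<^sub>R Z) Z"] line2 by blast
  have "\<psi> s - \<psi> 0 = s^2 * g'' (u + r *\<^sub>R X + t *\<^sub>R Z) Z"
    using 1 2 by (simp add: power2_eq_square)
  then show ?thesis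
    using r t by (intro exI[of _ r] exI[of _ t]) (simp add: \<psi>_def algebra_simps)
qed

text \<open>The second difference is symmetric in X and Z, so over a small parallelogram it is
  \<open>s^2\<close> times a value near u of either mixed derivative. Continuity of both at u then
  excludes different values there.\<close>

lemma symmetric_second_derivative_real:
  fixes g :: "'a::real_normed_vector \<Rightarrow> real"
  assumes "open U" "u \<in> U"
    and g: "\<And>x. x \<in> U \<Longrightarrow> (g has_derivative g' x) (at x)"
    and gX: "\<And>x. x \<in> U \<Longrightarrow> ((\<lambda>x. g' x X) has_derivative gX x) (at x)"
    and gZ: "\<And>x. x \<in> U \<Longrightarrow> ((\<lambda>x. g' x Z) has_derivative gZ x) (at x)"
    and cX: "isCont (\<lambda>x. gX x Z) u" and cZ: "isCont (\<lambda>x. gZ x X) u"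
  shows "gX u Z = gZ u X"
proof (rule ccontr)
  assume ne: "gX u Z \<noteq> gZ u X"
  \<comment> \<open>Half the supposed gap: no number lies within e of both derivatives.\<close>
  define e where "e = \<bar>gX u Z - gZ u X\<bar> / 2"
  have e: "e > 0" using ne by (simp add: e_def)
  obtain d0 where d0: "d0 > 0" "ball u d0 \<subseteq> U" using assms(1,2) openE by blast
  obtain d1 where d1: "d1 > 0" "\<And>x. dist x u < d1 \<Longrightarrow> \<bar>gX x Z - gX u Z\<bar> < e"
    using cX[unfolded continuous_at_eps_delta, rule_format, OF e] by (auto simp: dist_real_def)
  obtain d2 where d2: "d2 > 0" "\<And>x. dist x u < d2 \<Longrightarrow> \<bar>gZ x X - gZ u X\<bar> < e"
    using cZ[unfolded continuous_at_eps_delta, rule_format, OF e] by (auto simp: dist_real_def)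
  define d where "d = min d0 (min d1 d2)"
  have d: "d > 0" using d0 d1 d2 by (simp add: d_def)
  \<comment> \<open>Small enough that the whole parallelogram lies in the ball of radius d around
    u.\<close>
  define s where "s = d / (norm X + norm Z + 1)"
  have s: "s > 0" unfolding s_def using d by (intro divide_pos_pos) (auto simp: add_nonneg_pos)
  have near: "dist (u + r *\<^sub>R X + t *\<^sub>R Z) u < d" if "0 \<le> r" "r \<le> s" "0 \<le> t" "t \<le> s" for r t
  proof -
    have "dist (u + r *\<^sub>R X + t *\<^sub>R Z) u = norm (r *\<^sub>R X + t *\<^sub>R Z)" by (simp add: dist_norm add.assoc)
    also have "\<dots> \<le> r * norm X + t * norm Z"
      using norm_triangle_ineq[of "r *\<^sub>R X" "t *\<^sub>R Z"] that by simp
    also have "\<dots> \<le> s * norm X + s * norm Z"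
      using that by (intro add_mono mult_right_mono) auto
    also have "\<dots> < s * (norm X + norm Z + 1)" using s by (simp add: algebra_simps)
    also have "\<dots> = d" proof -
      have "norm X + norm Z + 1 \<noteq> 0" using norm_ge_zero[of X] norm_ge_zero[of Z] by linarith
      then show ?thesis by (simp add: s_def)
    qed
    finally show ?thesis .
  qed
  have sub: "u + r *\<^sub>R X + t *\<^sub>R Z \<in> U" if "0 \<le> r" "r \<le> s" "0 \<le> t" "t \<le> s" for r t
    using near[OF that] d0(2) by (auto simp: d_def dist_commute)
  have sub': "u + r *\<^sub>R Z + t *\<^sub>R X \<in> U" if "0 \<le> r" "r \<le> s" "0 \<le> t" "t \<le> s" for r t
    using sub[of t r] that by (simp add: algebra_simps)
  obtain r t where rt: "0 \<le> r" "r \<le> s" "0 \<le> t" "t \<le> s" and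
    1: "g (u + s *\<^sub>R X + s *\<^sub>R Z) - g (u + s *\<^sub>R X) - g (u + s *\<^sub>R Z) + g u
      = s^2 * gX (u + r *\<^sub>R X + t *\<^sub>R Z) Z"
    using second_difference_mvt[OF s sub g gX] by blast
  obtain r' t' where rt': "0 \<le> r'" "r' \<le> s" "0 \<le> t'" "t' \<le> s" and
    2: "g (u + s *\<^sub>R Z + s *\<^sub>R X) - g (u + s *\<^sub>R Z) - g (u + s *\<^sub>R X) + g u
      = s^2 * gZ (u + r' *\<^sub>R Z + t' *\<^sub>R X) X"
    using second_difference_mvt[OF s sub' g gZ] by blast
  have "s^2 * gX (u + r *\<^sub>R X + t *\<^sub>R Z) Z = s^2 * gZ (u + r' *\<^sub>R Z + t' *\<^sub>R X) X"
    using 1 2 by (simp add: algebra_simps)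
  then have eq: "gX (u + r *\<^sub>R X + t *\<^sub>R Z) Z = gZ (u + t' *\<^sub>R X + r' *\<^sub>R Z) X"
    using s by (simp add: algebra_simps)
  have "\<bar>gX (u + r *\<^sub>R X + t *\<^sub>R Z) Z - gX u Z\<bar> < e"
    using d1(2) near[OF rt] by (simp add: d_def)
  moreover have "\<bar>gZ (u + t' *\<^sub>R X + r' *\<^sub>R Z) X - gZ u X\<bar> < e"
    using d2(2) near[of t' r'] rt' by (simp add: d_def)
  ultimately show False using eq ne unfolding e_def by argo
qed

section \<open>Working rules for the coinductive smoothness predicate\<close>

abbreviation fderiv :: "('a::real_normed_vector \<Rightarrow> 'b::real_normed_vector) \<Rightarrow> 'a \<Rightarrow> 'a \<Rightarrow> 'b"
  where "fderiv f u X \<equiv> frechet_derivative f (at u) X"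

lemma Cinf_on_has_derivative:
  assumes "Cinf_on U f" "open U" "u \<in> U"
  shows "(f has_derivative fderiv f u) (at u)"
proof -
  have "f differentiable_on U" using assms(1) Cinf_on.cases by blast
  then have "f differentiable (at u)"
    using assms differentiable_on_eq_differentiable_at by blast
  then show ?thesis by (simp add: frechet_derivative_works)
qed

lemma Cinf_on_fderiv: "Cinf_on U f \<Longrightarrow> Cinf_on U (\<lambda>x. fderiv f x v)"
  by (erule Cinf_on.cases) auto

lemma Cinf_on_continuous_on: "Cinf_on U f \<Longrightarrow> continuous_on U f"
  by (meson Cinf_on.cases differentiable_imp_continuous_on)

lemma Cinf_on_symmetric_second:
  fixes f :: "'a::euclidean_space \<Rightarrow> 'b::euclidean_space"
  assumes C: "Cinf_on U f" and U: "open U" "u \<in> U"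
  shows "fderiv (\<lambda>x. fderiv f x X) u Z = fderiv (\<lambda>x. fderiv f x Z) u X"
proof (rule euclidean_eqI)
  fix b :: 'b assume "b \<in> Basis"
  have 1: "((\<lambda>x. f x \<bullet> b) has_derivative (\<lambda>v. fderiv f x v \<bullet> b)) (at x)" if "x \<in> U" for x
    using Cinf_on_has_derivative[OF C U(1) that] by (rule has_derivative_inner_left)
  have 2: "((\<lambda>x. fderiv f x V \<bullet> b) has_derivative (\<lambda>v. fderiv (\<lambda>x. fderiv f x V) x v \<bullet> b)) (at x)"
    if "x \<in> U" for x V
    using Cinf_on_has_derivative[OF Cinf_on_fderiv[OF C] U(1) that] by (rule has_derivative_inner_left)
  have 3: "isCont (\<lambda>x. fderiv (\<lambda>x. fderiv f x V) x W \<bullet> b) u" for V W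
    using Cinf_on_continuous_on[OF Cinf_on_fderiv[OF Cinf_on_fderiv[OF C]]] U
    by (intro continuous_intros) (simp add: continuous_on_eq_continuous_at)
  show "fderiv (\<lambda>x. fderiv f x X) u Z \<bullet> b = fderiv (\<lambda>x. fderiv f x Z) u X \<bullet> b"
    by (rule symmetric_second_derivative_real[OF U, of "\<lambda>x. f x \<bullet> b", OF 1 2 2 3 3])
qed

lemma fderiv_eq: "(f has_derivative f') (at u) \<Longrightarrow> fderiv f u X = f' X"
  by (metis frechet_derivative_at)

text \<open>Coinduction on the class R of maps that agree on V with \<open>L\<close> after a smooth
  map. Agreement on V is enough, because V is open and derivatives at its points see nothing outside
  it.\<close>

lemma Cinf_on_bounded_linear_image:
  assumes L: "bounded_linear L" and V: "open V" "V \<subseteq> U" and U: "open U"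
    and "Cinf_on U f" "\<And>x. x \<in> V \<Longrightarrow> g x = L (f x)"
  shows "Cinf_on V g"
proof -
  define R where "R g \<longleftrightarrow> (\<exists>f. Cinf_on U f \<and> (\<forall>x\<in>V. g x = L (f x)))" for g
  have "R g" using assms unfolding R_def by blast
  then show ?thesis
  proof (coinduction arbitrary: g)
    case Cinf_on
    then obtain f where f: "Cinf_on U f" "\<And>x. x \<in> V \<Longrightarrow> g x = L (f x)" unfolding R_def by blast
    have D: "(g has_derivative (\<lambda>v. L (fderiv f x v))) (at x)" if x: "x \<in> V" for x
    proof (rule has_derivative_transform_within_open[OF _ V(1) x])
      show "((\<lambda>x. L (f x)) has_derivative (\<lambda>v. L (fderiv f x v))) (at x)"
        by (rule bounded_linear.has_derivative[OF L Cinf_on_has_derivative[OF f(1) U]]) (use x V in blast)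
    qed (simp add: f(2))
    have "g differentiable_on V"
      using D by (auto simp: differentiable_on_def differentiable_def intro: has_derivative_at_withinI)
    moreover have "R (\<lambda>x. fderiv g x v)" for v
      unfolding R_def using Cinf_on_fderiv[OF f(1), of v] fderiv_eq[OF D] by blast
    ultimately show ?case by simp
  qed
qed

lemma Cinf_on_subset: "Cinf_on U f \<Longrightarrow> open U \<Longrightarrow> open V \<Longrightarrow> V \<subseteq> U \<Longrightarrow> Cinf_on V f"
  using Cinf_on_bounded_linear_image[OF bounded_linear_ident] by blast

section \<open>Lorentzian linear algebra and symmetric matrices\<close>

text \<open>Lorentzian cross product: \<open>lor (cr x y) z\<close> is the determinant of \<open>x, y, z\<close>.\<close>

definition cr :: "real^3 \<Rightarrow> real^3 \<Rightarrow> real^3" where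
  "cr x y = vector [x$3 * y$2 - x$2 * y$3, x$3 * y$1 - x$1 * y$3, x$1 * y$2 - x$2 * y$1]"

lemma cr_nth [simp]:
  "cr x y $ 1 = x$3 * y$2 - x$2 * y$3"
  "cr x y $ 2 = x$3 * y$1 - x$1 * y$3"
  "cr x y $ 3 = x$1 * y$2 - x$2 * y$1"
  by (simp_all add: cr_def)

lemma lor_commute: "lor x y = lor y x"
  by (simp add: lor_def)

lemma bounded_bilinear_lor: "bounded_bilinear lor"
proof -
  have "bilinear lor"
    unfolding bilinear_def by (auto intro!: linearI simp: lor_def algebra_simps)
  then show ?thesis by (simp add: bilinear_conv_bounded_bilinear)
qed

lemma bounded_bilinear_cr: "bounded_bilinear cr"
proof -
  have "bilinear cr"
    unfolding bilinear_def by (auto intro!: linearI simp: vec_eq_iff forall_3 algebra_simps)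
  then show ?thesis by (simp add: bilinear_conv_bounded_bilinear)
qed

interpretation lor: bounded_bilinear lor by (rule bounded_bilinear_lor)
interpretation cr: bounded_bilinear cr by (rule bounded_bilinear_cr)

lemmas lor_simps = lor.add_left lor.add_right lor.diff_left lor.diff_right
  lor.scaleR_left lor.scaleR_right lor.minus_left lor.minus_right lor.zero_left lor.zero_right

lemma lor_cr_left [simp]: "lor (cr x y) x = 0" "lor x (cr x y) = 0"
  and lor_cr_right [simp]: "lor (cr x y) y = 0" "lor y (cr x y) = 0"
  by (simp_all add: lor_def algebra_simps)

lemma cr_self [simp]: "cr x x = 0"
  by (simp add: vec_eq_iff forall_3)

lemma lor_cr_cr: "lor (cr x y) (cr x y) = (lor x y)^2 - lor x x * lor y y"
  by (simp add: lor_def algebra_simps power2_eq_square)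

lemma lor_cr_self: "lor x x = -1 \<Longrightarrow> lor x n = 0 \<Longrightarrow> lor (cr x n) (cr x n) = lor n n"
  by (simp add: lor_cr_cr)

text \<open>The vectors x, n and \<open>cr x n\<close> are orthogonal with squares -1,
  \<open>lor n n\<close> and \<open>lor n n\<close>. Multiplying by \<open>lor n n\<close> instead
  of dividing keeps the expansion valid for vanishing n.\<close>

lemma frame_expand:
  assumes "lor x x = -1" "lor x n = 0"
  shows "lor n n *\<^sub>R y = - (lor n n * lor y x) *\<^sub>R x + lor y n *\<^sub>R n + lor y (cr x n) *\<^sub>R cr x n"
  using assms unfolding vec_eq_iff forall_3 lor_def by (simp, intro conjI; algebra)

lemma lor_parseval:
  assumes "lor x x = -1" "lor x n = 0" "lor n n = 1"
  shows "lor y z = - lor y x * lor z x + lor y n * lor z n + lor y (cr x n) * lor z (cr x n)"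
proof -
  have "y = - lor y x *\<^sub>R x + lor y n *\<^sub>R n + lor y (cr x n) *\<^sub>R cr x n"
    using frame_expand[OF assms(1,2), of y] assms(3) by simp
  then have "lor y z = lor (- lor y x *\<^sub>R x + lor y n *\<^sub>R n + lor y (cr x n) *\<^sub>R cr x n) z"
    by simp
  then show ?thesis by (simp add: lor_simps lor_commute[of _ z])
qed

lemma H2_lor: "x \<in> H2 \<Longrightarrow> lor x x = -1"
  by (simp add: H2_def)

text \<open>The complement of a timelike vector is positive definite: after multiplication by
  \<open>(x$1)^2\<close>, tangency eliminates \<open>x$1 * v$1\<close> and a sum of squares
  remains.\<close>

lemma H2_lor_nonneg:
  assumes "lor x x = -1" "lor x v = 0"
  shows "lor v v \<ge> 0" and "lor v v = 0 \<Longrightarrow> v = 0"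
proof -
  have 1: "(x$1)^2 = 1 + (x$2)^2 + (x$3)^2" and 2: "x$1 * v$1 = x$2 * v$2 + x$3 * v$3"
    using assms by (auto simp: lor_def power2_eq_square)
  have "(x$1)^2 * lor v v = (v$2)^2 + (v$3)^2 + (x$2 * v$3 - x$3 * v$2)^2"
  proof -
    have "(x$1)^2 * lor v v = (x$1)^2 * ((v$2)^2 + (v$3)^2) - (x$1 * v$1)^2"
      by (simp add: lor_def algebra_simps power2_eq_square)
    also have "\<dots> = (1 + (x$2)^2 + (x$3)^2) * ((v$2)^2 + (v$3)^2) - (x$2 * v$2 + x$3 * v$3)^2"
      by (simp only: 1 2)
    finally show ?thesis by (simp add: algebra_simps power2_eq_square)
  qed
  moreover have "(x$1)^2 > 0" using 1 by (smt (verit) zero_le_power2)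
  ultimately show "lor v v \<ge> 0"
    by (metis add_nonneg_nonneg zero_le_mult_iff zero_le_power2 not_less)
  show "v = 0" if "lor v v = 0"
  proof -
    have "(v$2)^2 + (v$3)^2 + (x$2 * v$3 - x$3 * v$2)^2 = 0"
      using \<open>(x$1)^2 * lor v v = _\<close> that by simp
    then have "v$2 = 0" "v$3 = 0"
      by (smt (verit) zero_le_power2 power2_eq_square mult_eq_0_iff zero_eq_power2)+
    moreover then have "v$1 = 0" using 2 \<open>(x$1)^2 > 0\<close> by auto
    ultimately show ?thesis by (simp add: vec_eq_iff forall_3)
  qed
qed

text \<open>Used to tell the two sheets of the hyperboloid apart by the product with one point of
  the upper sheet.\<close>

lemma H2_lor_less:
  assumes "x \<in> H2" "lor y y = -1"
  shows "lor x y \<le> -1 \<longleftrightarrow> y$1 > 0" and "lor x y < 0 \<longleftrightarrow> y$1 > 0"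
proof -
  have x: "(x$1)^2 = 1 + (x$2)^2 + (x$3)^2" "x$1 > 0"
    using assms by (auto simp: H2_def lor_def power2_eq_square)
  have y: "(y$1)^2 = 1 + (y$2)^2 + (y$3)^2"
    using assms by (auto simp: lor_def power2_eq_square)
  \<comment> \<open>The projection of y to the tangent space at x; its square
    \<open>(lor x y)^2 - 1\<close> is nonnegative.\<close>
  have "lor x (y + lor x y *\<^sub>R x) = 0"
    using assms by (simp add: lor_simps H2_lor)
  from H2_lor_nonneg(1)[OF H2_lor[OF assms(1)] this]
  have sq: "(lor x y)^2 \<ge> 1"
    using assms H2_lor[OF assms(1)] by (simp add: lor_simps lor_commute[of y x] power2_eq_square)
  \<comment> \<open>By Lagrange's identity the time part dominates the space part, so
    \<open>lor x y\<close> has the sign opposite to \<open>x$1 * y$1\<close>.\<close>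
  have cs: "(x$2 * y$2 + x$3 * y$3)^2 < (x$1 * y$1)^2"
  proof -
    have "(x$1 * y$1)^2 = (1 + (x$2)^2 + (x$3)^2) * (1 + (y$2)^2 + (y$3)^2)"
      by (simp add: power_mult_distrib x y)
    also have "\<dots> = (x$2 * y$2 + x$3 * y$3)^2 + (x$2 * y$3 - x$3 * y$2)^2 + 1 + (x$2)^2 + (x$3)^2 + (y$2)^2 + (y$3)^2"
      by (simp add: power2_eq_square algebra_simps)
    finally show ?thesis by (smt (verit) zero_le_power2)
  qed
  then have ab: "\<bar>x$2 * y$2 + x$3 * y$3\<bar> < \<bar>x$1 * y$1\<bar>"
    using abs_le_square_iff[of "x$1 * y$1" "x$2 * y$2 + x$3 * y$3"] by linarith
  show *: "lor x y < 0 \<longleftrightarrow> y$1 > 0"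
  proof
    assume "lor x y < 0"
    then have "x$1 * y$1 > 0" using ab unfolding lor_def by linarith
    then show "y$1 > 0" using x(2) zero_less_mult_pos by blast
  next
    assume "y$1 > 0"
    then have "x$1 * y$1 > 0" using x(2) by simp
    then show "lor x y < 0" using ab unfolding lor_def by linarith
  qed
  have "lor x y < 0 \<longleftrightarrow> lor x y \<le> -1"
    using sq abs_square_le_1[of "lor x y"] abs_le_square_iff[of 1 "lor x y"] by auto
  then show "lor x y \<le> -1 \<longleftrightarrow> y$1 > 0" using * by simp
qed

lemma H2_unit_orth_exists:
  assumes "y \<in> H2"
  shows "\<exists>m. lor y m = 0 \<and> lor m m = 1"
proof -
  define r where "r = sqrt (1 + (y$3)^2)"
  have r: "r^2 = 1 + (y$3)^2" "r \<noteq> 0"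
    by (auto simp: r_def add_nonneg_eq_0_iff)
  have "(y$1)^2 = 1 + (y$2)^2 + (y$3)^2"
    using assms by (auto simp: H2_def lor_def power2_eq_square)
  \<comment> \<open>The vector with entries \<open>y$2, y$1, 0\<close> is orthogonal to y and has
    square \<open>(y$1)^2 - (y$2)^2 = 1 + (y$3)^2 = r^2\<close>.\<close>
  moreover define m :: "real^3" where "m = (1 / r) *\<^sub>R vector [y$2, y$1, 0]"
  ultimately have "lor m m = r^2 / r^2"
    using r by (simp add: lor_def power2_eq_square divide_simps)
  then have "lor y m = 0" "lor m m = 1"
    using r by (auto simp: lor_def m_def)
  then show ?thesis by blast
qed

section \<open>Symmetric 3 by 3 matrices with a double eigenvalue\<close>

text \<open>Here p, q, r are the diagonal and s, t, w the entries 12, 13, 23 of a symmetric matrix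
  with eigenvalues d, 0, 0; the conclusion is its spectral decomposition.\<close>

lemma symmetric_rank_one_real:
  fixes p q r s t w d :: real
  assumes tr: "p + q + r = d"
    and m: "p * q - s^2 + (p * r - t^2) + (q * r - w^2) = 0"
    and det: "p * q * r + 2 * s * t * w - p * w^2 - q * t^2 - r * s^2 = 0"
  shows "\<exists>x y z. x^2 + y^2 + z^2 = 1 \<and> p = d * x^2 \<and> q = d * y^2 \<and> r = d * z^2
    \<and> s = d * x * y \<and> t = d * x * z \<and> w = d * y * z"
proof (cases "d = 0")
  case True
  \<comment> \<open>The squared norm of the matrix is the squared trace minus twice the second
    invariant, so the matrix vanishes and any unit vector serves.\<close>
  have "p^2 + q^2 + r^2 + 2 * s^2 + 2 * t^2 + 2 * w^2 = (p + q + r)^2 - 2 * (p * q - s^2 + (p * r - t^2) + (q * r - w^2))"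
    by (simp add: power2_eq_square algebra_simps)
  also have "\<dots> = 0" using tr m True by simp
  finally have "p^2 + q^2 + r^2 + 2 * s^2 + 2 * t^2 + 2 * w^2 = 0" .
  then have "p = 0" "q = 0" "r = 0" "s = 0" "t = 0" "w = 0"
    by (smt (verit) zero_le_power2 zero_eq_power2)+
  then show ?thesis using True by (intro exI[of _ 1] exI[of _ 0]) simp
next
  case False
  \<comment> \<open>the squares of all 2 by 2 minors add up to zero, so the matrix has rank at most one\<close>
  have "(p * q - s^2)^2 + (p * r - t^2)^2 + (q * r - w^2)^2
      + 2 * (p * w - s * t)^2 + 2 * (q * t - s * w)^2 + 2 * (r * s - t * w)^2
    = (p * q - s^2 + (p * r - t^2) + (q * r - w^2))^2
      - 2 * (p + q + r) * (p * q * r + 2 * s * t * w - p * w^2 - q * t^2 - r * s^2)"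
    by (simp add: power2_eq_square algebra_simps)
  also have "\<dots> = 0" using m det by simp
  finally have sq: "(p * q - s^2)^2 + (p * r - t^2)^2 + (q * r - w^2)^2
      + 2 * (p * w - s * t)^2 + 2 * (q * t - s * w)^2 + 2 * (r * s - t * w)^2 = 0" .
  have "p * q - s^2 = 0" "p * r - t^2 = 0" "q * r - w^2 = 0"
    "p * w - s * t = 0" "q * t - s * w = 0" "r * s - t * w = 0"
    using sq by (smt (verit) zero_le_power2 zero_eq_power2)+
  then have mn: "p * q = s * s" "p * r = t * t" "q * r = w * w" "p * w = s * t" "q * t = s * w" "r * s = t * w"
    by (auto simp: power2_eq_square)
  \<comment> \<open>If p is nonzero, so is the first column \<open>(p, s, t)\<close>; it has squared
    length \<open>d * p\<close> and, normalised, is the eigenvector. The other pivots reduce to this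
    one by permuting the axes.\<close>
  have key: "\<exists>x y z. x^2 + y^2 + z^2 = 1 \<and> p = d * x^2 \<and> q = d * y^2 \<and> r = d * z^2
    \<and> s = d * x * y \<and> t = d * x * z \<and> w = d * y * z"
    if "p \<noteq> 0" "p + q + r = d" "p * q = s * s" "p * r = t * t" "p * w = s * t" for p q r s t w
  proof -
    have dp: "d * p = p^2 + s^2 + t^2" 
    proof -
      have "d * p = p * p + p * q + p * r" unfolding that(2)[symmetric] by (simp add: algebra_simps)
      then show ?thesis using that(3,4) by (simp add: power2_eq_square)
    qed
    have pos: "d * p > 0"
      unfolding dp using that(1) by (smt (verit) zero_le_power2 zero_eq_power2)
    define c where "c = sqrt (d * p)"
    have c: "c * c = d * p" "c \<noteq> 0" using pos by (auto simp: c_def)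
    have "(p / c)^2 + (s / c)^2 + (t / c)^2 = (p^2 + s^2 + t^2) / (c * c)"
      by (simp add: power2_eq_square add_divide_distrib)
    also have "\<dots> = 1" using dp c pos by simp
    finally have 1: "(p / c)^2 + (s / c)^2 + (t / c)^2 = 1" .
    have q: "q = d * (s / c)^2" "r = d * (t / c)^2" "w = d * (s / c) * (t / c)"
         "p = d * (p / c)^2" "s = d * (p / c) * (s / c)" "t = d * (p / c) * (t / c)"
      using c that False by (simp_all add: power2_eq_square eq_divide_eq mult.commute)
    show ?thesis using 1 q by (intro exI[of _ "p / c"] exI[of _ "s / c"] exI[of _ "t / c"]) simp
  qed
  consider "p \<noteq> 0" | "q \<noteq> 0" | "r \<noteq> 0" using tr False by force
  then show ?thesis
  proof cases
    case 1
    then show ?thesis using key[of p q r s t w] tr mn by simp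
  next
    case 2
    obtain x y z where "x^2 + y^2 + z^2 = 1 \<and> q = d * x^2 \<and> p = d * y^2 \<and> r = d * z^2
      \<and> s = d * x * y \<and> w = d * x * z \<and> t = d * y * z"
      using key[of q p r s w t] 2 tr mn by (auto simp: mult.commute add.commute add.left_commute)
    then show ?thesis by (intro exI[of _ y] exI[of _ x] exI[of _ z]) (simp add: algebra_simps)
  next
    case 3
    obtain x y z where "x^2 + y^2 + z^2 = 1 \<and> r = d * x^2 \<and> q = d * y^2 \<and> p = d * z^2
      \<and> w = d * x * y \<and> t = d * x * z \<and> s = d * y * z"
      using key[of r q p w t s] 3 tr mn by (auto simp: mult.commute add.commute add.left_commute)
    then show ?thesis by (intro exI[of _ z] exI[of _ y] exI[of _ x]) (simp add: algebra_simps)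
  qed
qed

lemma charpoly3:
  fixes B :: "real^3^3"
  shows "det (mat x - B) = x^3 - (B$1$1 + B$2$2 + B$3$3) * x^2
    + (B$1$1 * B$2$2 - B$1$2 * B$2$1 + (B$1$1 * B$3$3 - B$1$3 * B$3$1) + (B$2$2 * B$3$3 - B$2$3 * B$3$2)) * x
    - det B"
  by (simp add: det_3 mat_def power2_eq_square power3_eq_cube algebra_simps)

text \<open>Both cubics are monic, so the values at 0, 1 and -1 fix the other three
  coefficients.\<close>

lemma cubic_coeffs_eq:
  fixes c2 :: real
  assumes "\<And>x. x^3 - c2 * x^2 + c1 * x - c0 = (x - k1) * (x - k2) * (x - k3)"
  shows "c2 = k1 + k2 + k3" "c1 = k1 * k2 + k1 * k3 + k2 * k3" "c0 = k1 * k2 * k3"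
  using assms[of 0] assms[of 1] assms[of "-1"] by (simp_all add: algebra_simps)

lemma trace3_of_charpoly:
  fixes B :: "real^3^3"
  assumes "\<And>x. det (mat x - B) = (x - k1) * (x - k2) * (x - k3)"
  shows "B$1$1 + B$2$2 + B$3$3 = k1 + k2 + k3"
  by (rule cubic_coeffs_eq(1)[OF assms[unfolded charpoly3]])

lemma symmetric_rank_one:
  fixes B :: "real^3^3"
  assumes ch: "\<And>x. det (mat x - B) = (x - a) * (x - b) * (x - b)"
    and sym: "\<And>i j. B$i$j = B$j$i"
  shows "\<exists>k::real^3. (k$1)^2 + (k$2)^2 + (k$3)^2 = 1 \<and>
    (\<forall>i j. B$i$j = (if i = j then b else 0) + (a - b) * k$i * k$j)"
proof -
  have s: "B$2$1 = B$1$2" "B$3$1 = B$1$3" "B$3$2 = B$2$3" using sym by blast+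
  note c = cubic_coeffs_eq[OF ch[unfolded charpoly3], unfolded s det_3]
  \<comment> \<open>The trace, second invariant and determinant of B minus b times the identity,
    whose eigenvalues are a - b, 0, 0.\<close>
  have tr: "(B$1$1 - b) + (B$2$2 - b) + (B$3$3 - b) = a - b" using c(1) by simp
  have m: "(B$1$1 - b) * (B$2$2 - b) - (B$1$2)^2 + ((B$1$1 - b) * (B$3$3 - b) - (B$1$3)^2)
    + ((B$2$2 - b) * (B$3$3 - b) - (B$2$3)^2) = 0"
    using c(1,2) by algebra
  have d: "(B$1$1 - b) * (B$2$2 - b) * (B$3$3 - b) + 2 * B$1$2 * B$1$3 * B$2$3
     - (B$1$1 - b) * (B$2$3)^2 - (B$2$2 - b) * (B$1$3)^2 - (B$3$3 - b) * (B$1$2)^2 = 0"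
    using c by algebra
  obtain x y z where k: "x^2 + y^2 + z^2 = 1" "B$1$1 - b = (a - b) * x^2" "B$2$2 - b = (a - b) * y^2"
    "B$3$3 - b = (a - b) * z^2"
    "B$1$2 = (a - b) * x * y" "B$1$3 = (a - b) * x * z" "B$2$3 = (a - b) * y * z"
    using symmetric_rank_one_real[OF tr m d] by blast
  show ?thesis
    by (intro exI[of _ "vector [x, y, z]"])
      (use k s in \<open>simp add: forall_3 power2_eq_square algebra_simps\<close>)
qed

section \<open>The shape matrix in an orthonormal frame\<close>

lemma matrix_of_bilinear_congruence:
  fixes \<beta> :: "real^3 \<Rightarrow> real^3 \<Rightarrow> real"
  assumes "bilinear \<beta>"
  shows "transpose (\<chi> i j. X j $ i) ** (\<chi> i j. \<beta> (axis i 1) (axis j 1)) ** (\<chi> i j. X j $ i)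
    = (\<chi> i j. \<beta> (X i) (X j))"
proof -
  have e: "v = v$1 *\<^sub>R axis 1 1 + v$2 *\<^sub>R axis 2 1 + v$3 *\<^sub>R axis 3 1" for v :: "real^3"
    by (simp add: vec_eq_iff forall_3 axis_def)
  have E: "\<beta> v w = (\<Sum>l\<in>UNIV. (\<Sum>k\<in>UNIV. v$k * \<beta> (axis k 1) (axis l 1)) * w$l)" for v w
    by (subst e[of v], subst e[of w])
      (simp add: sum_3 bilinear_ladd[OF assms] bilinear_radd[OF assms] bilinear_lmul[OF assms] bilinear_rmul[OF assms] algebra_simps)
  show ?thesis
    by (simp add: matrix_matrix_mult_def transpose_def vec_eq_iff E[symmetric])
qed

text \<open>Let \<Lambda> have the frame vectors as columns. Orthonormality turns the congruence of
  \<open>g ** (mat x - matrix_inv g ** h)\<close> by \<Lambda> into \<open>mat x\<close> minus the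
  matrix of \<eta> in the frame, and it makes the extra factor
  \<open>det \<Lambda> * det g * det \<Lambda>\<close> equal to 1.\<close>

lemma det_shape_orthonormal:
  fixes \<beta> \<eta> :: "real^3 \<Rightarrow> real^3 \<Rightarrow> real" and X :: "3 \<Rightarrow> real^3"
  assumes "bilinear \<beta>" "bilinear \<eta>"
    and orth: "\<And>i j. \<beta> (X i) (X j) = (if i = j then 1 else 0)"
  shows "det (mat x - matrix_inv (\<chi> i j. \<beta> (axis i 1) (axis j 1)) ** (\<chi> i j. \<eta> (axis i 1) (axis j 1)))
    = det (mat x - (\<chi> i j. \<eta> (X i) (X j)))"
proof -
  define g where "g = (\<chi> i j. \<beta> (axis i 1) (axis j 1))"
  define h where "h = (\<chi> i j. \<eta> (axis i 1) (axis j 1))"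
  define \<Lambda> where "\<Lambda> = (\<chi> i j. X j $ i)"
  have 1: "transpose \<Lambda> ** g ** \<Lambda> = mat 1"
    unfolding \<Lambda>_def g_def matrix_of_bilinear_congruence[OF assms(1)] by (simp add: orth mat_def)
  have 2: "transpose \<Lambda> ** h ** \<Lambda> = (\<chi> i j. \<eta> (X i) (X j))"
    unfolding \<Lambda>_def h_def matrix_of_bilinear_congruence[OF assms(2)] ..
  have d: "det \<Lambda> * det g * det \<Lambda> = 1"
    using arg_cong[OF 1, of det] by (simp add: det_mul det_transpose)
  then have "det g \<noteq> 0" by auto
  then have inv: "g ** matrix_inv g = mat 1"
    unfolding matrix_inv_def invertible_det_nz[symmetric] invertible_def
    by (rule someI2_ex) blast
  have mx: "mat x = x *\<^sub>R (mat 1 :: real^3^3)"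
    by (simp add: mat_def vec_eq_iff)
  have mdl: "A ** (B - C) = A ** B - A ** C" and mdr: "(B - C) ** A = B ** A - C ** A"
    for A B C :: "real^3^3"
    by (simp_all add: matrix_matrix_mult_def vec_eq_iff sum_subtractf algebra_simps)
  have "transpose \<Lambda> ** (g ** (mat x - matrix_inv g ** h)) ** \<Lambda> = mat x - (\<chi> i j. \<eta> (X i) (X j))"
    unfolding mx
    by (simp add: mdl mdr matrix_scalar_ac scalar_matrix_assoc[symmetric] matrix_mul_assoc inv 2 1)
  from arg_cong[OF this, of det]
  have "det \<Lambda> * (det g * det (mat x - matrix_inv g ** h)) * det \<Lambda> = det (mat x - (\<chi> i j. \<eta> (X i) (X j)))"
    unfolding det_mul det_transpose .
  moreover have "det \<Lambda> * (det g * det (mat x - matrix_inv g ** h)) * det \<Lambda>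
     = (det \<Lambda> * det g * det \<Lambda>) * det (mat x - matrix_inv g ** h)" by simp
  ultimately have "det (mat x - matrix_inv g ** h) = det (mat x - (\<chi> i j. \<eta> (X i) (X j)))"
    by (simp only: d)
  then show ?thesis by (simp only: g_def h_def)
qed

section \<open>Immersed hypersurfaces in coordinates\<close>

lemma linear_fderiv:
  assumes "Cinf_on U f" "open U" "u \<in> U"
  shows "linear (fderiv f u)"
  using Cinf_on_has_derivative[OF assms] has_derivative_linear by blast

text \<open>The data of one chart, with the two factors kept apart so that they can be exchanged.
  Curvatures are prescribed through the second fundamental form in every orthonormal frame, which
  avoids inverting the first form.\<close>

locale immersed =
  fixes U :: "(real^3) set" and f1 f2 n1 n2 :: "real^3 \<Rightarrow> real^3" and k1 k2 k3 :: real
  assumes open_U: "open U"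
    and smooth: "Cinf_on U f1" "Cinf_on U f2" "Cinf_on U n1" "Cinf_on U n2"
    and f_H2: "\<And>u. u \<in> U \<Longrightarrow> f1 u \<in> H2" "\<And>u. u \<in> U \<Longrightarrow> f2 u \<in> H2"
    and n_tangent: "\<And>u. u \<in> U \<Longrightarrow> lor (f1 u) (n1 u) = 0" "\<And>u. u \<in> U \<Longrightarrow> lor (f2 u) (n2 u) = 0"
    and n_unit: "\<And>u. u \<in> U \<Longrightarrow> lor (n1 u) (n1 u) + lor (n2 u) (n2 u) = 1"
    and n_normal: "\<And>u X. u \<in> U \<Longrightarrow> lor (n1 u) (fderiv f1 u X) + lor (n2 u) (fderiv f2 u X) = 0"
    and immersion: "\<And>u X. u \<in> U \<Longrightarrow> fderiv f1 u X = 0 \<Longrightarrow> fderiv f2 u X = 0 \<Longrightarrow> X = 0"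
    and curvatures: "\<And>u X x. u \<in> U \<Longrightarrow>
      (\<And>i j. lor (fderiv f1 u (X i)) (fderiv f1 u (X j)) + lor (fderiv f2 u (X i)) (fderiv f2 u (X j))
          = (if i = (j::3) then 1 else 0)) \<Longrightarrow>
      det (mat x - (\<chi> i j. - (lor (fderiv n1 u (X i)) (fderiv f1 u (X j))
          + lor (fderiv n2 u (X i)) (fderiv f2 u (X j))))) = (x - k1) * (x - k2) * (x - k3)"
begin

lemma swapped: "immersed U f2 f1 n2 n1 k1 k2 k3"
proof unfold_locales
  fix u X x assume u: "u \<in> U" and o: "\<And>i j. lor (fderiv f2 u (X i)) (fderiv f2 u (X j)) + lor (fderiv f1 u (X i)) (fderiv f1 u (X j))
          = (if i = (j::3) then 1 else 0)"
  show "det (mat x - (\<chi> i j. - (lor (fderiv n2 u (X i)) (fderiv f2 u (X j))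
          + lor (fderiv n1 u (X i)) (fderiv f1 u (X j))))) = (x - k1) * (x - k2) * (x - k3)"
    using curvatures[OF u, of X x] o by (simp add: add.commute)
qed (use open_U smooth f_H2 n_tangent n_unit n_normal immersion in \<open>auto simp: add.commute\<close>)

lemma restrict: "open V \<Longrightarrow> V \<subseteq> U \<Longrightarrow> immersed V f1 f2 n1 n2 k1 k2 k3"
  by unfold_locales
    (use smooth[THEN Cinf_on_subset, OF open_U] f_H2 n_tangent n_unit n_normal immersion curvatures in \<open>auto simp: subset_iff\<close>)

abbreviation F1 where "F1 \<equiv> fderiv f1"
abbreviation F2 where "F2 \<equiv> fderiv f2"
abbreviation N1 where "N1 \<equiv> fderiv n1"
abbreviation N2 where "N2 \<equiv> fderiv n2"
abbreviation FF1 where "FF1 u X Z \<equiv> fderiv (\<lambda>x. fderiv f1 x X) u Z"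
abbreviation FF2 where "FF2 u X Z \<equiv> fderiv (\<lambda>x. fderiv f2 x X) u Z"
abbreviation NN1 where "NN1 u X Z \<equiv> fderiv (\<lambda>x. fderiv n1 x X) u Z"
abbreviation NN2 where "NN2 u X Z \<equiv> fderiv (\<lambda>x. fderiv n2 x X) u Z"

lemmas D1 = smooth[THEN Cinf_on_has_derivative, OF open_U]
lemmas D2 = smooth[THEN Cinf_on_fderiv, THEN Cinf_on_has_derivative, OF open_U]
lemmas sym2 = smooth[THEN Cinf_on_symmetric_second, OF open_U]
lemmas lin = smooth[THEN linear_fderiv, OF open_U]

text \<open>Up to the factors 1/p and 1/q, the image of X in the first factor has components
  \<open>tau\<close>, \<open>th1\<close> along \<open>n1\<close> and its rotation
  \<open>cr f1 n1\<close>, and in the second factor \<open>- tau\<close>, \<open>th2\<close> along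
  \<open>n2\<close> and \<open>cr f2 n2\<close>. Where p and q are nonzero these are coordinates on
  the tangent space.\<close>

definition tau where "tau u X = lor (n1 u) (F1 u X)"
definition th1 where "th1 u X = lor (F1 u X) (cr (f1 u) (n1 u))"
definition th2 where "th2 u X = lor (F2 u X) (cr (f2 u) (n2 u))"
definition p where "p u = lor (n1 u) (n1 u)"
definition q where "q u = lor (n2 u) (n2 u)"
definition g where "g u X Y = lor (F1 u X) (F1 u Y) + lor (F2 u X) (F2 u Y)"
text \<open>The form g(PX, Y) of the product structure P.\<close>

definition gP where "gP u X Y = lor (F1 u X) (F1 u Y) - lor (F2 u X) (F2 u Y)"
definition h where "h u X Y = - (lor (N1 u X) (F1 u Y) + lor (N2 u X) (F2 u Y))"

context fixes u assumes u: "u \<in> U" begin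

lemma f_lor: "lor (f1 u) (f1 u) = -1" "lor (f2 u) (f2 u) = -1"
  using f_H2[OF u] H2_lor by auto

lemma F_tangent: "lor (f1 u) (F1 u X) = 0" "lor (f2 u) (F2 u X) = 0"
proof -
  have "lor (f1 u) (F1 u X) + lor (F1 u X) (f1 u) = 0"
    by (rule has_derivative_zero_on_open[OF open_U u _ lor.FDERIV[OF D1(1)[OF u] D1(1)[OF u]], where c = "-1"])
      (use f_H2 H2_lor in auto)
  then show "lor (f1 u) (F1 u X) = 0" by (simp add: lor_commute)
  have "lor (f2 u) (F2 u X) + lor (F2 u X) (f2 u) = 0"
    by (rule has_derivative_zero_on_open[OF open_U u _ lor.FDERIV[OF D1(2)[OF u] D1(2)[OF u]], where c = "-1"])
      (use f_H2 H2_lor in auto)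
  then show "lor (f2 u) (F2 u X) = 0" by (simp add: lor_commute)
qed

lemma n2_F2: "lor (n2 u) (F2 u X) = - tau u X"
  using n_normal[OF u, of X] by (simp add: tau_def)

lemma f_N: "lor (f1 u) (N1 u X) = - tau u X" "lor (f2 u) (N2 u X) = tau u X"
proof -
  have "lor (f1 u) (N1 u X) + lor (F1 u X) (n1 u) = 0"
    by (rule has_derivative_zero_on_open[OF open_U u _ lor.FDERIV[OF D1(1)[OF u] D1(3)[OF u]], where c = 0])
      (use n_tangent in auto)
  then show "lor (f1 u) (N1 u X) = - tau u X" by (simp add: lor_commute[of "F1 u X"] tau_def)
  have "lor (f2 u) (N2 u X) + lor (F2 u X) (n2 u) = 0"
    by (rule has_derivative_zero_on_open[OF open_U u _ lor.FDERIV[OF D1(2)[OF u] D1(4)[OF u]], where c = 0])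
      (use n_tangent in auto)
  then show "lor (f2 u) (N2 u X) = tau u X" by (simp add: lor_commute[of "F2 u X"] n2_F2)
qed

lemma n_N: "lor (n1 u) (N1 u X) + lor (n2 u) (N2 u X) = 0"
proof -
  have "lor (n1 u) (N1 u X) + lor (N1 u X) (n1 u) + (lor (n2 u) (N2 u X) + lor (N2 u X) (n2 u)) = 0"
    by (rule has_derivative_zero_on_open[OF open_U u _ has_derivative_add[OF
        lor.FDERIV[OF D1(3)[OF u] D1(3)[OF u]] lor.FDERIV[OF D1(4)[OF u] D1(4)[OF u]]], where c = 1])
      (use n_unit in auto)
  then show ?thesis by (simp add: lor_commute)
qed

lemma f_FF: "lor (f1 u) (FF1 u X Z) = - lor (F1 u X) (F1 u Z)" "lor (f2 u) (FF2 u X Z) = - lor (F2 u X) (F2 u Z)"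
proof -
  have "lor (f1 u) (FF1 u X Z) + lor (F1 u Z) (F1 u X) = 0"
    by (rule has_derivative_zero_on_open[OF open_U u _ lor.FDERIV[OF D1(1)[OF u] D2(1)[OF u]], where c = 0])
      (rule immersed.F_tangent[OF immersed_axioms])
  then show "lor (f1 u) (FF1 u X Z) = - lor (F1 u X) (F1 u Z)" by (simp add: lor_commute)
  have "lor (f2 u) (FF2 u X Z) + lor (F2 u Z) (F2 u X) = 0"
    by (rule has_derivative_zero_on_open[OF open_U u _ lor.FDERIV[OF D1(2)[OF u] D2(2)[OF u]], where c = 0])
      (rule immersed.F_tangent[OF immersed_axioms])
  then show "lor (f2 u) (FF2 u X Z) = - lor (F2 u X) (F2 u Z)" by (simp add: lor_commute)
qed

text \<open>Differentiating normality trades derivatives of the normal for second derivatives of the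
  chart, whose symmetry makes \<open>h\<close> symmetric.\<close>

lemma h_eq: "h u Z X = lor (n1 u) (FF1 u X Z) + lor (n2 u) (FF2 u X Z)"
proof -
  have "lor (n1 u) (FF1 u X Z) + lor (N1 u Z) (F1 u X) + (lor (n2 u) (FF2 u X Z) + lor (N2 u Z) (F2 u X)) = 0"
    by (rule has_derivative_zero_on_open[OF open_U u _ has_derivative_add[OF
        lor.FDERIV[OF D1(3)[OF u] D2(1)[OF u]] lor.FDERIV[OF D1(4)[OF u] D2(2)[OF u]]], where c = 0])
      (use n_normal in auto)
  then show ?thesis by (simp add: h_def)
qed

lemma h_sym: "h u X Y = h u Y X"
  by (simp add: h_eq sym2[OF u])

lemma tau_deriv: "((\<lambda>u. tau u X) has_derivative (\<lambda>Z. lor (n1 u) (FF1 u X Z) + lor (N1 u Z) (F1 u X))) (at u)"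
  unfolding tau_def by (rule lor.FDERIV[OF D1(3)[OF u] D2(1)[OF u]])

lemma bil_g: "bilinear (g u)" and bil_h: "bilinear (h u)"
  unfolding bilinear_def g_def h_def
  by (auto intro!: linearI simp: linear_add[OF lin(1)[OF u]] linear_add[OF lin(2)[OF u]] linear_add[OF lin(3)[OF u]]
    linear_add[OF lin(4)[OF u]] linear_scale[OF lin(1)[OF u]] linear_scale[OF lin(2)[OF u]] linear_scale[OF lin(3)[OF u]]
    linear_scale[OF lin(4)[OF u]] lor_simps algebra_simps)

lemma g_sym: "g u X Y = g u Y X"
  by (simp add: g_def lor_commute)

lemma tangent_zero:
  assumes "lor (f1 u) v1 = 0" "lor (f2 u) v2 = 0" "lor v1 v1 + lor v2 v2 = 0"
  shows "v1 = 0" "v2 = 0"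
  using H2_lor_nonneg[OF f_lor(1) assms(1)] H2_lor_nonneg[OF f_lor(2) assms(2)] assms(3) by auto

end

text \<open>With \<open>n2 = 0\<close> the image of a tangent vector in the first factor is a
  multiple of the unit vector \<open>t\<close>, and \<open>h\<close> vanishes on vectors tangent to
  the second factor. So the \<open>t\<close> direction carries the whole trace of the shape
  operator.\<close>

lemma first_factor_normal:
  assumes n2: "\<And>u. u \<in> U \<Longrightarrow> n2 u = 0" and u: "u \<in> U"
  shows "N1 u X = - (k1 + k2 + k3) *\<^sub>R F1 u X"
proof -
  have pu: "lor (n1 u) (n1 u) = 1" using n_unit[OF u] n2[OF u] by (simp add: lor_simps)
  have N2: "N2 u Y = 0" for Y
    by (rule has_derivative_zero_on_open[OF open_U u n2 D1(4)[OF u]])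
  have tau: "tau u Y = 0" for Y using n2_F2[OF u, of Y] n2[OF u] by (simp add: lor_simps)
  define t where "t = cr (f1 u) (n1 u)"
  have ex1: "y = - lor y (f1 u) *\<^sub>R f1 u + lor y (n1 u) *\<^sub>R n1 u + lor y t *\<^sub>R t" for y
    using frame_expand[OF f_lor(1)[OF u] n_tangent(1)[OF u], of y] pu unfolding t_def by simp
  have tt: "lor t t = 1" unfolding t_def using lor_cr_self[OF f_lor(1)[OF u] n_tangent(1)[OF u]] pu by simp
  have F1t: "F1 u Y = lor (F1 u Y) t *\<^sub>R t" for Y
    using ex1[of "F1 u Y"] F_tangent(1)[OF u, of Y] tau[of Y] by (simp add: tau_def lor_commute)
  have "lor (n1 u) (N1 u Y) = 0" for Y using n_N[OF u, of Y] N2 by (simp add: lor_simps)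
  then have N1t: "N1 u Y = lor (N1 u Y) t *\<^sub>R t" for Y
    using ex1[of "N1 u Y"] f_N(1)[OF u, of Y] tau[of Y] by (simp add: tau_def lor_commute)
  \<comment> \<open>Since \<open>n2\<close> vanishes, the frame of the second factor has to start
    from an arbitrary unit tangent vector.\<close>
  obtain m where m: "lor (f2 u) m = 0" "lor m m = 1" using H2_unit_orth_exists f_H2(2)[OF u] by blast
  define m' where "m' = cr (f2 u) m"
  have ex2: "y = - lor y (f2 u) *\<^sub>R f2 u + lor y m *\<^sub>R m + lor y m' *\<^sub>R m'" for y
    using frame_expand[OF f_lor(2)[OF u] m(1), of y] m(2) unfolding m'_def by simp
  have mm: "lor m' m' = 1" "lor m m' = 0" "lor m' m = 0"
    unfolding m'_def using lor_cr_self[OF f_lor(2)[OF u] m(1)] m(2) by simp_all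
  have F2m: "F2 u Y = lor (F2 u Y) m *\<^sub>R m + lor (F2 u Y) m' *\<^sub>R m'" for Y
    using ex2[of "F2 u Y"] F_tangent(2)[OF u, of Y] by (simp add: lor_commute)
  define T :: "real^3 \<Rightarrow> real^3" where "T Y = vector [lor (F1 u Y) t, lor (F2 u Y) m, lor (F2 u Y) m']" for Y
  have linT: "linear T"
    by (rule linearI) (simp_all add: T_def vec_eq_iff forall_3 linear_add[OF lin(1)[OF u]] linear_add[OF lin(2)[OF u]]
        linear_scale[OF lin(1)[OF u]] linear_scale[OF lin(2)[OF u]] lor_simps)
  have "inj T"
  proof (subst linear_injective_0[OF linT], safe)
    fix Y assume "T Y = 0"
    then have "lor (F1 u Y) t = 0" "lor (F2 u Y) m = 0" "lor (F2 u Y) m' = 0"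
      by (auto simp: T_def vec_eq_iff forall_3)
    then show "Y = 0" using F1t[of Y] F2m[of Y] immersion[OF u] by simp
  qed
  then have "surj T" using linT linear_injective_imp_surjective by blast
  then obtain X1 X2 X3 where X: "T X1 = vector [1, 0, 0]" "T X2 = vector [0, 1, 0]" "T X3 = vector [0, 0, 1]"
    by (metis surjD)
  have F: "F1 u X1 = t" "F2 u X1 = 0" "F1 u X2 = 0" "F2 u X2 = m" "F1 u X3 = 0" "F2 u X3 = m'"
    using F1t[of X1] F2m[of X1] F1t[of X2] F2m[of X2] F1t[of X3] F2m[of X3] X
    by (auto simp: T_def vec_eq_iff[of "vector _"] forall_3)
  define XX :: "3 \<Rightarrow> real^3" where "XX i = (if i = 1 then X1 else if i = 2 then X2 else X3)" for i
  have XX: "XX 1 = X1" "XX 2 = X2" "XX 3 = X3" by (auto simp: XX_def)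
  have orth: "lor (F1 u (XX i)) (F1 u (XX j)) + lor (F2 u (XX i)) (F2 u (XX j)) = (if i = j then 1 else 0)" for i j
  proof -
    have "\<forall>i j. lor (F1 u (XX i)) (F1 u (XX j)) + lor (F2 u (XX i)) (F2 u (XX j)) = (if i = j then 1 else 0)"
      unfolding forall_3 XX by (simp add: F lor_simps tt m mm)
    then show ?thesis by blast
  qed
  \<comment> \<open>On \<open>X2\<close> and \<open>X3\<close> the form \<open>h\<close> is zero, so
    its trace is the single entry at \<open>X1\<close>.\<close>
  have "h u X1 X1 = k1 + k2 + k3"
    using trace3_of_charpoly[OF curvatures[OF u orth]] unfolding XX by (simp add: XX F N2 lor_simps h_def)
  then have a: "lor (N1 u X1) t = - (k1 + k2 + k3)" by (simp add: h_def F N2 lor_simps)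
  \<comment> \<open>Symmetry of \<open>h\<close> carries the value found at \<open>X1\<close> over
    to arbitrary X.\<close>
  have "- lor (N1 u X) t = h u X X1" by (simp add: h_def F N2 lor_simps)
  also have "\<dots> = h u X1 X" by (rule h_sym[OF u])
  also have "\<dots> = - lor (N1 u X1) (F1 u X)" by (simp add: h_def N2 lor_simps)
  also have "\<dots> = - lor (F1 u X) t * lor (N1 u X1) t" by (subst F1t) (simp add: lor_simps)
  finally have "lor (N1 u X) t = - (k1 + k2 + k3) * lor (F1 u X) t" using a by simp
  then show ?thesis using N1t[of X] F1t[of X] by (metis scaleR_scaleR)
qed

end

section \<open>The region where both components of the normal are nonzero\<close>

locale nondegenerate = immersed U f1 f2 n1 n2 a b b for U f1 f2 n1 n2 a b +
  assumes p_nz: "\<And>u. u \<in> U \<Longrightarrow> p u \<noteq> 0" and q_nz: "\<And>u. u \<in> U \<Longrightarrow> q u \<noteq> 0"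
begin

text \<open>The g-product of X with the vector of coordinates c in the orthonormal frame
  \<open>(J n\<^sub>1, 0)/sqrt p\<close>, \<open>(0, J n\<^sub>2)/sqrt q\<close>,
  \<open>(q n\<^sub>1, - p n\<^sub>2)/sqrt (pq)\<close>.\<close>

definition ell where "ell (c::real^3) u X = c$1 * th1 u X / sqrt (p u) + c$2 * th2 u X / sqrt (q u)
  + c$3 * tau u X / (sqrt (p u) * sqrt (q u))"

definition \<beta> where "\<beta> u X Y = h u X Y - b * g u X Y"

text \<open>The product rule for \<beta>(X, Y) in direction Z, with X and Y held fixed in the
  parameter space.\<close>

definition D\<beta> where "D\<beta> u X Y Z =
  - (lor (N1 u X) (FF1 u Y Z) + lor (NN1 u X Z) (F1 u Y) + (lor (N2 u X) (FF2 u Y Z) + lor (NN2 u X Z) (F2 u Y)))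
  - b * (lor (F1 u X) (FF1 u Y Z) + lor (FF1 u X Z) (F1 u Y) + (lor (F2 u X) (FF2 u Y Z) + lor (FF2 u X Z) (F2 u Y)))"

definition rank_one where "rank_one u c \<longleftrightarrow> (\<forall>X Y. \<beta> u X Y = (a - b) * ell c u X * ell c u Y)"

context fixes u assumes u: "u \<in> U" begin

lemma pq_pos: "p u > 0" "q u > 0" "p u + q u = 1"
  using H2_lor_nonneg(1)[OF f_lor(1)[OF u] n_tangent(1)[OF u]]
    H2_lor_nonneg(1)[OF f_lor(2)[OF u] n_tangent(2)[OF u]] p_nz[OF u] q_nz[OF u] n_unit[OF u]
  by (auto simp: p_def q_def)

lemma expand1: "v = - lor v (f1 u) *\<^sub>R f1 u + (lor v (n1 u) / p u) *\<^sub>R n1 u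
    + (lor v (cr (f1 u) (n1 u)) / p u) *\<^sub>R cr (f1 u) (n1 u)"
proof -
  have "v = (1 / p u) *\<^sub>R (p u *\<^sub>R v)" using pq_pos by simp
  also have "\<dots> = (1 / p u) *\<^sub>R (- (p u * lor v (f1 u)) *\<^sub>R f1 u + lor v (n1 u) *\<^sub>R n1 u
      + lor v (cr (f1 u) (n1 u)) *\<^sub>R cr (f1 u) (n1 u))"
    using frame_expand[OF f_lor(1)[OF u] n_tangent(1)[OF u], of v] by (simp add: p_def)
  finally show ?thesis using pq_pos by (simp add: algebra_simps)
qed

lemma expand2: "v = - lor v (f2 u) *\<^sub>R f2 u + (lor v (n2 u) / q u) *\<^sub>R n2 u
    + (lor v (cr (f2 u) (n2 u)) / q u) *\<^sub>R cr (f2 u) (n2 u)"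
proof -
  have "v = (1 / q u) *\<^sub>R (q u *\<^sub>R v)" using pq_pos by simp
  also have "\<dots> = (1 / q u) *\<^sub>R (- (q u * lor v (f2 u)) *\<^sub>R f2 u + lor v (n2 u) *\<^sub>R n2 u
      + lor v (cr (f2 u) (n2 u)) *\<^sub>R cr (f2 u) (n2 u))"
    using frame_expand[OF f_lor(2)[OF u] n_tangent(2)[OF u], of v] by (simp add: q_def)
  finally show ?thesis using pq_pos by (simp add: algebra_simps)
qed

lemma F1_eq: "F1 u X = (tau u X / p u) *\<^sub>R n1 u + (th1 u X / p u) *\<^sub>R cr (f1 u) (n1 u)"
  using expand1[of "F1 u X"] F_tangent(1)[OF u, of X]
  by (simp add: tau_def th1_def lor_commute[of _ "f1 u"] lor_commute[of _ "n1 u"])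

lemma F2_eq: "F2 u X = (- tau u X / q u) *\<^sub>R n2 u + (th2 u X / q u) *\<^sub>R cr (f2 u) (n2 u)"
  using expand2[of "F2 u X"] F_tangent(2)[OF u, of X] n2_F2[OF u, of X]
  by (simp add: th2_def lor_commute[of _ "f2 u"] lor_commute[of _ "n2 u"])

lemma FF_inner: "lor (F1 u X) (F1 u Y) = (tau u X * tau u Y + th1 u X * th1 u Y) / p u"
  "lor (F2 u X) (F2 u Y) = (tau u X * tau u Y + th2 u X * th2 u Y) / q u"
proof -
  have "lor (F1 u X) (F1 u Y) = (tau u X / p u) * tau u Y + (th1 u X / p u) * th1 u Y"
    by (subst F1_eq[of X]) (simp add: lor_simps tau_def th1_def lor_commute)
  then show "lor (F1 u X) (F1 u Y) = (tau u X * tau u Y + th1 u X * th1 u Y) / p u"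
    by (simp add: add_divide_distrib)
  have "lor (F2 u X) (F2 u Y) = (- tau u X / q u) * (- tau u Y) + (th2 u X / q u) * th2 u Y"
    by (subst F2_eq[of X]) (simp add: lor_simps n2_F2[OF u] th2_def lor_commute[of "cr _ _" "F2 u Y"])
  then show "lor (F2 u X) (F2 u Y) = (tau u X * tau u Y + th2 u X * th2 u Y) / q u"
    by (simp add: add_divide_distrib)
qed

lemma coord_linear: "linear (th1 u)" "linear (th2 u)" "linear (tau u)"
  by (auto intro!: linearI simp: th1_def th2_def tau_def linear_add[OF lin(1)[OF u]] linear_add[OF lin(2)[OF u]]
        linear_scale[OF lin(1)[OF u]] linear_scale[OF lin(2)[OF u]] lor_simps)

lemma coord_inj: "th1 u X = th1 u Y \<Longrightarrow> th2 u X = th2 u Y \<Longrightarrow> tau u X = tau u Y \<Longrightarrow> X = Y"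
proof -
  assume "th1 u X = th1 u Y" "th2 u X = th2 u Y" "tau u X = tau u Y"
  then have "F1 u (X - Y) = 0" "F2 u (X - Y) = 0"
    using F1_eq[of X] F1_eq[of Y] F2_eq[of X] F2_eq[of Y]
    by (simp_all add: linear_diff[OF lin(1)[OF u]] linear_diff[OF lin(2)[OF u]])
  then show "X = Y" using immersion[OF u] by fastforce
qed

lemma coord_surj: obtains X where "th1 u X = x" "th2 u X = y" "tau u X = z"
proof -
  define T :: "real^3 \<Rightarrow> real^3" where "T Y = vector [th1 u Y, th2 u Y, tau u Y]" for Y
  have "linear T"
    by (rule linearI) (simp_all add: T_def vec_eq_iff forall_3 linear_add[OF coord_linear(1)] linear_add[OF coord_linear(2)]
        linear_add[OF coord_linear(3)] linear_scale[OF coord_linear(1)] linear_scale[OF coord_linear(2)] linear_scale[OF coord_linear(3)])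
  moreover have "inj T"
    by (rule injI) (auto simp: T_def vec_eq_iff[of "vector _"] forall_3 intro: coord_inj)
  ultimately have "surj T" using linear_injective_imp_surjective by blast
  then obtain X where "T X = vector [x, y, z]" by (metis surjD)
  then have "th1 u X = x" "th2 u X = y" "tau u X = z"
    by (auto simp: T_def vec_eq_iff[of "vector _"] forall_3)
  then show ?thesis by (rule that)
qed

lemma coord_frame: obtains X where "th1 u X = x * sqrt (p u)" "th2 u X = y * sqrt (q u)"
    "tau u X = z * (sqrt (p u) * sqrt (q u))"
  using coord_surj .

lemma sqrt_pq: "sqrt (p u) * sqrt (p u) = p u" "sqrt (q u) * sqrt (q u) = q u" "sqrt (p u) \<noteq> 0" "sqrt (q u) \<noteq> 0"
  using pq_pos by auto

lemma g_coord: "g u X Y = th1 u X * th1 u Y / p u + th2 u X * th2 u Y / q u + tau u X * tau u Y / (p u * q u)"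
proof -
  have "1 / p u + 1 / q u = 1 / (p u * q u)" using pq_pos by (simp add: divide_simps)
  then have "tau u X * tau u Y * (1 / p u + 1 / q u) = tau u X * tau u Y * (1 / (p u * q u))" by simp
  then show ?thesis
    by (simp add: g_def FF_inner add_divide_distrib distrib_left)
qed

lemma gP_coord: "gP u X Y = th1 u X * th1 u Y / p u - th2 u X * th2 u Y / q u + tau u X * tau u Y * (1 / p u - 1 / q u)"
  by (simp add: gP_def FF_inner add_divide_distrib algebra_simps)

text \<open>A vector tangent to the ambient space and orthogonal to the normal is the image of some
  X; being orthogonal to all such images, it is orthogonal to itself.\<close>

lemma tangent_eq_zero:
  assumes "lor (f1 u) v1 = 0" "lor (f2 u) v2 = 0" "lor (n1 u) v1 + lor (n2 u) v2 = 0"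
    and "\<And>Y. lor v1 (F1 u Y) + lor v2 (F2 u Y) = 0"
  shows "v1 = 0" "v2 = 0"
proof -
  obtain X where X: "th1 u X = lor v1 (cr (f1 u) (n1 u))" "th2 u X = lor v2 (cr (f2 u) (n2 u))" "tau u X = lor v1 (n1 u)"
    using coord_surj .
  have v2: "lor v2 (n2 u) = - tau u X" using assms(3) X(3) by (simp add: lor_commute)
  have "F1 u X = v1" using expand1[of v1] F1_eq[of X] X assms(1) by (simp add: lor_commute[of v1 "f1 u"])
  moreover have "F2 u X = v2" using expand2[of v2] F2_eq[of X] X v2 assms(2) by (simp add: lor_commute[of v2 "f2 u"])
  ultimately show "v1 = 0" "v2 = 0" using tangent_zero[OF u assms(1,2)] assms(4)[of X] by auto
qed

text \<open>Weingarten equation when \<open>s\<close> times the pair \<open>w1, w2\<close>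
  represents \<beta>(X, .). The terms in \<open>f1\<close> and \<open>f2\<close> come from the
  curvature of the two hyperboloids; the difference of both sides is killed by
  \<open>tangent_eq_zero\<close>.\<close>

lemma N_eq:
  assumes "\<And>Y. \<beta> u X Y = s * (lor w1 (F1 u Y) + lor w2 (F2 u Y))"
    and "lor (f1 u) w1 = 0" "lor (f2 u) w2 = 0" "lor (n1 u) w1 + lor (n2 u) w2 = 0"
  shows "N1 u X = - b *\<^sub>R F1 u X + tau u X *\<^sub>R f1 u - s *\<^sub>R w1"
    "N2 u X = - b *\<^sub>R F2 u X - tau u X *\<^sub>R f2 u - s *\<^sub>R w2"
proof -
  define v1 where "v1 = N1 u X + b *\<^sub>R F1 u X - tau u X *\<^sub>R f1 u + s *\<^sub>R w1"
  define v2 where "v2 = N2 u X + b *\<^sub>R F2 u X + tau u X *\<^sub>R f2 u + s *\<^sub>R w2"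
  have 1: "lor (f1 u) v1 = 0" "lor (f2 u) v2 = 0"
    unfolding v1_def v2_def
    by (simp_all add: lor_simps f_N[OF u] F_tangent[OF u] f_lor[OF u] assms)
  have 2: "lor (n1 u) v1 + lor (n2 u) v2 = 0"
  proof -
    have "lor (n1 u) v1 + lor (n2 u) v2 = (lor (n1 u) (N1 u X) + lor (n2 u) (N2 u X))
      + b * (lor (n1 u) (F1 u X) + lor (n2 u) (F2 u X)) + s * (lor (n1 u) w1 + lor (n2 u) w2)"
      unfolding v1_def v2_def using n_tangent[OF u]
      by (simp add: lor_simps lor_commute[of "n1 u" "f1 u"] lor_commute[of "n2 u" "f2 u"] algebra_simps)
    then show ?thesis using n_N[OF u] n_normal[OF u] assms(4) by simp
  qed
  have 3: "lor v1 (F1 u Y) + lor v2 (F2 u Y) = 0" for Y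
  proof -
    have "lor v1 (F1 u Y) + lor v2 (F2 u Y) = - \<beta> u X Y + s * (lor w1 (F1 u Y) + lor w2 (F2 u Y))"
      unfolding v1_def v2_def \<beta>_def h_def g_def
      by (simp add: lor_simps F_tangent[OF u] algebra_simps)
    then show ?thesis using assms(1) by simp
  qed
  have "N1 u X = v1 - b *\<^sub>R F1 u X + tau u X *\<^sub>R f1 u - s *\<^sub>R w1"
    "N2 u X = v2 - b *\<^sub>R F2 u X - tau u X *\<^sub>R f2 u - s *\<^sub>R w2"
    unfolding v1_def v2_def by simp_all
  then show "N1 u X = - b *\<^sub>R F1 u X + tau u X *\<^sub>R f1 u - s *\<^sub>R w1"
    "N2 u X = - b *\<^sub>R F2 u X - tau u X *\<^sub>R f2 u - s *\<^sub>R w2"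
    using tangent_eq_zero[OF 1 2 3] by simp_all
qed

lemma N_ker:
  assumes "\<And>Y. \<beta> u X Y = 0"
  shows "N1 u X = - b *\<^sub>R F1 u X + tau u X *\<^sub>R f1 u" "N2 u X = - b *\<^sub>R F2 u X - tau u X *\<^sub>R f2 u"
  using N_eq[of X 0 0 0] assms by (simp_all add: lor_simps)

lemma \<beta>_deriv: "((\<lambda>u. \<beta> u X Y) has_derivative D\<beta> u X Y) (at u)"
  unfolding \<beta>_def h_def g_def
  by (rule has_derivative_eq_rhs, (rule has_derivative_diff has_derivative_minus has_derivative_add
      has_derivative_mult_right lor.FDERIV D1[OF u] D2[OF u])+)
    (simp add: fun_eq_iff D\<beta>_def)

text \<open>For X and Z in the kernel of \<beta>, all second derivatives in D\<beta>(X, Y, Z) enter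
  symmetrically in X and Z except those paired with the \<open>f1\<close>, \<open>f2\<close> terms
  of dn. The latter produce \<open>tau u X * gP u Y Z\<close>.\<close>

lemma codazzi:
  assumes "\<And>V. \<beta> u X V = 0" "\<And>V. \<beta> u Z V = 0" "D\<beta> u X Y Z = D\<beta> u Z Y X"
  shows "tau u X * gP u Y Z = tau u Z * gP u Y X"
proof -
  have e: "D\<beta> u X Y Z = tau u X * gP u Y Z
    - (lor (NN1 u X Z) (F1 u Y) + lor (NN2 u X Z) (F2 u Y) + b * (lor (FF1 u X Z) (F1 u Y) + lor (FF2 u X Z) (F2 u Y)))"
    if "\<And>V. \<beta> u X V = 0" for X Z
    unfolding D\<beta>_def N_ker[OF that] gP_def
    by (simp add: lor_simps f_FF[OF u] algebra_simps)
  show ?thesis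
    using assms(3) unfolding e[OF assms(1)] e[OF assms(2)] sym2[OF u, of Z X] by simp
qed

lemma \<beta>_bilinear: "bilinear (\<beta> u)"
  unfolding bilinear_def \<beta>_def
  by (auto intro!: linearI simp: bilinear_ladd[OF bil_g[OF u]] bilinear_radd[OF bil_g[OF u]] bilinear_lmul[OF bil_g[OF u]]
    bilinear_rmul[OF bil_g[OF u]] bilinear_ladd[OF bil_h[OF u]] bilinear_radd[OF bil_h[OF u]] bilinear_lmul[OF bil_h[OF u]]
    bilinear_rmul[OF bil_h[OF u]] algebra_simps)

lemma \<beta>_sym: "\<beta> u X Y = \<beta> u Y X"
  unfolding \<beta>_def h_sym[OF u, of X Y] g_sym[OF u, of X Y] ..

text \<open>In the orthonormal frame \<open>X1, X2, X3\<close> the matrix of \<open>h\<close> is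
  symmetric with eigenvalues a, b, b, so the spectral lemma applies; bilinearity extends the formula
  from the frame to all vectors.\<close>

lemma rank_one_exists:
  "\<exists>k::real^3. (k$1)^2 + (k$2)^2 + (k$3)^2 = 1 \<and> rank_one u k"
proof -
  obtain X1 where X1: "th1 u X1 = 1 * sqrt (p u)" "th2 u X1 = 0 * sqrt (q u)" "tau u X1 = 0 * (sqrt (p u) * sqrt (q u))"
    using coord_frame .
  obtain X2 where X2: "th1 u X2 = 0 * sqrt (p u)" "th2 u X2 = 1 * sqrt (q u)" "tau u X2 = 0 * (sqrt (p u) * sqrt (q u))"
    using coord_frame .
  obtain X3 where X3: "th1 u X3 = 0 * sqrt (p u)" "th2 u X3 = 0 * sqrt (q u)" "tau u X3 = 1 * (sqrt (p u) * sqrt (q u))"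
    using coord_frame .
  define XX :: "3 \<Rightarrow> real^3" where "XX i = (if i = 1 then X1 else if i = 2 then X2 else X3)" for i
  have XX: "XX 1 = X1" "XX 2 = X2" "XX 3 = X3" by (auto simp: XX_def)
  define s where "s = sqrt (p u)"
  define t where "t = sqrt (q u)"
  note st = sqrt_pq[folded s_def t_def]
  note X1 = X1[folded s_def t_def] and X2 = X2[folded s_def t_def] and X3 = X3[folded s_def t_def]
  have orth': "\<forall>i j. g u (XX i) (XX j) = (if i = j then 1 else 0)"
    unfolding forall_3 XX g_coord X1 X2 X3 st(1,2)[symmetric] using st(3,4) by simp
  then have orth: "\<And>i j. lor (F1 u (XX i)) (F1 u (XX j)) + lor (F2 u (XX i)) (F2 u (XX j)) = (if i = j then 1 else 0)"
    by (simp add: g_def)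
  define B where "B = (\<chi> i j. h u (XX i) (XX j))"
  have ch: "det (mat x - B) = (x - a) * (x - b) * (x - b)" for x
    using curvatures[OF u orth, of x] unfolding B_def h_def .
  have sym: "B$i$j = B$j$i" for i j unfolding B_def using h_sym[OF u] by simp
  obtain k :: "real^3" where k: "(k$1)^2 + (k$2)^2 + (k$3)^2 = 1"
    "\<And>i j. B$i$j = (if i = j then b else 0) + (a - b) * k$i * k$j"
    using symmetric_rank_one[OF ch sym] by blast
  have \<beta>k: "\<beta> u (XX i) (XX j) = (a - b) * k$i * k$j" for i j
    using k(2)[of i j] orth' by (simp add: B_def \<beta>_def)
  note \<beta>XX = \<beta>k[of 1 1, unfolded XX] \<beta>k[of 1 2, unfolded XX] \<beta>k[of 1 3, unfolded XX] \<beta>k[of 2 1, unfolded XX]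
    \<beta>k[of 2 2, unfolded XX] \<beta>k[of 2 3, unfolded XX] \<beta>k[of 3 1, unfolded XX] \<beta>k[of 3 2, unfolded XX] \<beta>k[of 3 3, unfolded XX]
  have dec: "X = (th1 u X / s) *\<^sub>R X1 + (th2 u X / t) *\<^sub>R X2 + (tau u X / (s * t)) *\<^sub>R X3" for X
    by (rule coord_inj) (use st in \<open>simp_all add: X1 X2 X3 linear_add[OF coord_linear(1)] linear_add[OF coord_linear(2)]
        linear_add[OF coord_linear(3)] linear_scale[OF coord_linear(1)] linear_scale[OF coord_linear(2)] linear_scale[OF coord_linear(3)]\<close>)
  have "\<beta> u X Y = (a - b) * ell k u X * ell k u Y" for X Y
  proof -
    have *: "\<beta> u (x1 *\<^sub>R X1 + x2 *\<^sub>R X2 + x3 *\<^sub>R X3) (y1 *\<^sub>R X1 + y2 *\<^sub>R X2 + y3 *\<^sub>R X3)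
      = (a - b) * (k$1 * x1 + k$2 * x2 + k$3 * x3) * (k$1 * y1 + k$2 * y2 + k$3 * y3)" for x1 x2 x3 y1 y2 y3
      by (simp add: bilinear_ladd[OF \<beta>_bilinear] bilinear_radd[OF \<beta>_bilinear] bilinear_lmul[OF \<beta>_bilinear]
          bilinear_rmul[OF \<beta>_bilinear] \<beta>XX) (simp add: algebra_simps)
    show ?thesis
      by (subst dec[of X], subst dec[of Y], subst *) (simp add: ell_def s_def t_def)
  qed
  then show ?thesis using k(1) unfolding rank_one_def by blast
qed

end

text \<open>By the rank one form, (a - b) \<beta>(X, X) is a square at every point, so its zeros are
  minima. For a = b the form \<beta> vanishes identically.\<close>

lemma D\<beta>_zero_diag:
  assumes u: "u \<in> U" and z: "\<beta> u X X = 0"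
  shows "D\<beta> u X X Z = 0"
proof -
  have sgn: "(a - b) * \<beta> v X X \<ge> 0" "a = b \<Longrightarrow> \<beta> v X X = 0" if v: "v \<in> U" for v
  proof -
    obtain k where "\<beta> v X X = (a - b) * ell k v X * ell k v X"
      using rank_one_exists[OF v] unfolding rank_one_def by blast
    then show "(a - b) * \<beta> v X X \<ge> 0" "a = b \<Longrightarrow> \<beta> v X X = 0"
      using zero_le_square[of "(a - b) * ell k v X"] by (simp_all add: ac_simps)
  qed
  show ?thesis
  proof (cases "a = b")
    case True
    show ?thesis
      by (rule has_derivative_zero_on_open[OF open_U u _ \<beta>_deriv[OF u]]) (use sgn True in auto)
  next
    case False
    have "((\<lambda>v. (a - b) * \<beta> v X X) has_derivative (\<lambda>Z. (a - b) * D\<beta> u X X Z)) (at u)"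
      by (rule has_derivative_mult_right[OF \<beta>_deriv[OF u]])
    from differential_zero_maxmin[OF u open_U this]
    have "(\<lambda>Z. (a - b) * D\<beta> u X X Z) = (\<lambda>v. 0)" using sgn(1) z by auto
    then have "(a - b) * D\<beta> u X X Z = 0" by (rule fun_cong)
    then show ?thesis using False by simp
  qed
qed

text \<open>Polarisation of the diagonal case, the kernel being a linear space.\<close>

lemma D\<beta>_zero:
  assumes u: "u \<in> U" and X: "\<And>V. \<beta> u X V = 0" and Y: "\<And>V. \<beta> u Y V = 0"
  shows "D\<beta> u X Y Z = 0"
proof -
  have "\<beta> u (X + Y) (X + Y) = 0"
    using X Y by (simp add: bilinear_ladd[OF \<beta>_bilinear[OF u]])
  note z = D\<beta>_zero_diag[OF u this, of Z] D\<beta>_zero_diag[OF u X, of Z] D\<beta>_zero_diag[OF u Y, of Z]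
  have "((\<lambda>v. \<beta> v (X + Y) (X + Y) - \<beta> v X X - \<beta> v Y Y - 2 * \<beta> v X Y) has_derivative
    (\<lambda>Z. D\<beta> u (X + Y) (X + Y) Z - D\<beta> u X X Z - D\<beta> u Y Y Z - 2 * D\<beta> u X Y Z)) (at u)"
    by (intro has_derivative_diff has_derivative_mult_right \<beta>_deriv[OF u])
  from has_derivative_zero_on_open[OF open_U u _ this, of 0 Z]
  have "D\<beta> u (X + Y) (X + Y) Z - D\<beta> u X X Z - D\<beta> u Y Y Z - 2 * D\<beta> u X Y Z = 0"
    by (simp add: bilinear_ladd[OF \<beta>_bilinear] bilinear_radd[OF \<beta>_bilinear] \<beta>_sym[of _ Y X])
  then show ?thesis using z by simp
qed

lemma ker_codazzi:
  assumes "u \<in> U" "\<And>V. \<beta> u X V = 0" "\<And>V. \<beta> u Y V = 0" "\<And>V. \<beta> u Z V = 0"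
  shows "tau u X * gP u Y Z = tau u Z * gP u Y X"
  using codazzi[OF assms(1,2,4)] D\<beta>_zero[OF assms(1)] assms by simp

lemma rank_one_directions:
  assumes u: "u \<in> U" and r: "rank_one u k" and k: "(k$1)^2 + (k$2)^2 + (k$3)^2 = 1"
  shows "k$1 = 0 \<and> k$2 = 0 \<or> k$3 = 0 \<and> (k$1)^2 = (k$2)^2"
proof (rule disjCI)
  assume ne: "\<not> (k$3 = 0 \<and> (k$1)^2 = (k$2)^2)"
  show "k$1 = 0 \<and> k$2 = 0"
  proof (rule ccontr)
    assume "\<not> (k$1 = 0 \<and> k$2 = 0)"
    then have nz: "(k$1)^2 + (k$2)^2 \<noteq> 0" by (simp add: sum_power2_eq_zero_iff)
    define s where "s = sqrt (p u)"
    define t where "t = sqrt (q u)"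
    note st = sqrt_pq[OF u, folded s_def t_def]
    \<comment> \<open>In frame coordinates X is \<open>(- k1 k3, - k2 k3, k1^2 + k2^2)\<close> and Z
      is \<open>(k2, - k1, 0)\<close>. Both are orthogonal to k, hence in the kernel. As tau is zero
      on Z but not on X, the Codazzi relation gives gP(Z, Z) = gP(X, Z) = 0.\<close>
    obtain X where X: "th1 u X = (- k$1 * k$3) * s" "th2 u X = (- k$2 * k$3) * t" "tau u X = ((k$1)^2 + (k$2)^2) * (s * t)"
      using coord_frame[OF u, folded s_def t_def] .
    obtain Z where Z: "th1 u Z = (k$2) * s" "th2 u Z = (- k$1) * t" "tau u Z = 0 * (s * t)"
      using coord_frame[OF u, folded s_def t_def] .
    have "ell k u X = 0" "ell k u Z = 0"
      unfolding ell_def X Z s_def[symmetric] t_def[symmetric] using st by (simp_all add: power2_eq_square field_simps)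
    then have ker: "\<beta> u X V = 0" "\<beta> u Z V = 0" for V using r unfolding rank_one_def by auto
    have tz: "tau u Z = 0" "tau u X \<noteq> 0" using X Z nz st by simp_all
    have "gP u Z Z = 0" "gP u X Z = 0"
      using ker_codazzi[OF u, of X Z Z] ker_codazzi[OF u, of X X Z] ker tz by simp_all
    moreover have "gP u Z Z = (k$2)^2 - (k$1)^2"
      unfolding gP_coord[OF u] Z st(1,2)[symmetric] using st(3,4) by (simp add: power2_eq_square field_simps)
    moreover have "gP u X Z = - 2 * k$1 * k$2 * k$3"
      unfolding gP_coord[OF u] X Z st(1,2)[symmetric] using st(3,4) by (simp add: field_simps)
    ultimately show False using ne nz by auto
  qed
qed

text \<open>If a = b then \<beta> = 0 and every direction is admissible, even the first frame
  vector, which \<open>rank_one_directions\<close> forbids.\<close>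

lemma a_neq_b: "u \<in> U \<Longrightarrow> a \<noteq> b"
proof
  assume u: "u \<in> U" and ab: "a = b"
  have "rank_one u (vector [1, 0, 0])"
    using rank_one_exists[OF u] ab unfolding rank_one_def by simp
  from rank_one_directions[OF u this] show False by simp
qed

text \<open>Directions of the image of \<open>\<beta>\<close> in the orthonormal frame
  \<open>(J n\<^sub>1, 0)/sqrt p\<close>, \<open>(0, J n\<^sub>2)/sqrt q\<close>, \<open>(q n\<^sub>1, - p n\<^sub>2)/sqrt (pq)\<close> of the tangent space, where \<open>J v = cr (f\<^sub>i) v\<close>.\<close>

definition cI :: "real^3" where "cI = vector [0, 0, 1]"
definition cII :: "real \<Rightarrow> real^3" where "cII e = vector [1 / sqrt 2, e / sqrt 2, 0]"

lemma rank_one_cases: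
  assumes u: "u \<in> U"
  shows "rank_one u cI \<or> rank_one u (cII 1) \<or> rank_one u (cII (-1))"
proof -
  obtain k :: "real^3" where k: "(k$1)^2 + (k$2)^2 + (k$3)^2 = 1" and r: "rank_one u k"
    using rank_one_exists[OF u] by blast
  \<comment> \<open>Only the square of the covector enters \<beta>, so a factor with square one is
    harmless; this normalises the sign of k.\<close>
  have scale: "rank_one u c" if "\<And>X. ell k u X = s * ell c u X" "s * s = 1" for s c
  proof -
    have "\<beta> u X Y = (s * s) * ((a - b) * ell c u X * ell c u Y)" for X Y
      using r unfolding rank_one_def that(1) by (simp add: algebra_simps)
    then show ?thesis unfolding rank_one_def that(2) by simp
  qed
  from rank_one_directions[OF u r k] show ?thesis
  proof
    assume "k$1 = 0 \<and> k$2 = 0"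
    then show ?thesis using scale[of "k$3" cI] k by (simp add: ell_def cI_def power2_eq_square)
  next
    assume k3: "k$3 = 0 \<and> (k$1)^2 = (k$2)^2"
    then have k1: "(k$1)^2 = 1/2" using k by simp
    have s: "(k$1 * sqrt 2) * (k$1 * sqrt 2) = 1"
    proof -
      have "(k$1 * sqrt 2) * (k$1 * sqrt 2) = (k$1)^2 * (sqrt 2 * sqrt 2)" by (simp only: power2_eq_square ac_simps)
      then show ?thesis using k1 by simp
    qed
    have "k$2 = k$1 \<or> k$2 = - k$1" using k3 power2_eq_iff by metis
    then show ?thesis
    proof
      assume "k$2 = k$1"
      then show ?thesis using scale[of "k$1 * sqrt 2" "cII 1"] k3 s by (simp add: ell_def cII_def algebra_simps)
    next
      assume "k$2 = - k$1"
      then show ?thesis using scale[of "k$1 * sqrt 2" "cII (-1)"] k3 s by (simp add: ell_def cII_def algebra_simps)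
    qed
  qed
qed

end

section \<open>Exclusion of the image direction of type \<open>cII\<close>\<close>

context nondegenerate begin

lemma swapped_nondegenerate: "nondegenerate U f2 f1 n2 n1 a b"
proof -
  interpret S: immersed U f2 f1 n2 n1 a b b by (rule swapped)
  show ?thesis
    by unfold_locales (use p_nz q_nz in \<open>auto simp: p_def q_def S.p_def S.q_def\<close>)
qed

lemma restrict_nondegenerate: "open V \<Longrightarrow> V \<subseteq> U \<Longrightarrow> nondegenerate V f1 f2 n1 n2 a b"
  using restrict[of V] p_nz q_nz by (simp add: nondegenerate_def nondegenerate_axioms_def subset_iff)

lemma p_deriv: "u \<in> U \<Longrightarrow> (p has_derivative (\<lambda>Z. 2 * lor (n1 u) (N1 u Z))) (at u)"
  unfolding p_def[abs_def]
  by (rule has_derivative_eq_rhs[OF lor.FDERIV[OF D1(3) D1(3)]]) (auto simp: lor_commute)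

lemma q_deriv: "u \<in> U \<Longrightarrow> (q has_derivative (\<lambda>Z. 2 * lor (n2 u) (N2 u Z))) (at u)"
  unfolding q_def[abs_def]
  by (rule has_derivative_eq_rhs[OF lor.FDERIV[OF D1(4) D1(4)]]) (auto simp: lor_commute)

lemma th1_deriv: "u \<in> U \<Longrightarrow> ((\<lambda>u. th1 u X) has_derivative (\<lambda>Z. lor (F1 u X) (cr (f1 u) (N1 u Z) + cr (F1 u Z) (n1 u))
    + lor (FF1 u X Z) (cr (f1 u) (n1 u)))) (at u)"
  unfolding th1_def by (intro lor.FDERIV cr.FDERIV D1 D2)

lemma th2_deriv: "u \<in> U \<Longrightarrow> ((\<lambda>u. th2 u X) has_derivative (\<lambda>Z. lor (F2 u X) (cr (f2 u) (N2 u Z) + cr (F2 u Z) (n2 u))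
    + lor (FF2 u X Z) (cr (f2 u) (n2 u)))) (at u)"
  unfolding th2_def by (intro lor.FDERIV cr.FDERIV D1 D2)

text \<open>Each direction type is a closed condition. As the three types exclude one another, each
  is then also open, so its defining relation can be differentiated.\<close>

lemma open_not_rank_one: "open {u \<in> U. \<not> rank_one u c}"
proof -
  define \<phi> where "\<phi> X Y u = \<beta> u X Y - (a - b) * ell c u X * ell c u Y" for X Y u
  have cont: "continuous_on U (\<lambda>u. th1 u X)" "continuous_on U (\<lambda>u. th2 u X)" "continuous_on U (\<lambda>u. tau u X)"
    "continuous_on U p" "continuous_on U q" "continuous_on U (\<lambda>u. \<beta> u X Y)" for X Y
    by (rule has_derivative_continuous_on, rule has_derivative_at_withinI, erule th1_deriv th2_deriv tau_deriv p_deriv q_deriv \<beta>_deriv)+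
  have "continuous_on U (\<phi> X Y)" for X Y
    unfolding \<phi>_def[abs_def] ell_def
    by (intro continuous_intros cont) (use p_nz q_nz in auto)
  then have "open (U \<inter> \<phi> X Y -` (- {0}))" for X Y
    using open_U by (intro continuous_open_preimage) auto
  then have "open (\<Union>X Y. U \<inter> \<phi> X Y -` (- {0}))" by blast
  also have "(\<Union>X Y. U \<inter> \<phi> X Y -` (- {0})) = {u \<in> U. \<not> rank_one u c}"
    unfolding rank_one_def \<phi>_def by (simp add: set_eq_iff)
  finally show ?thesis .
qed

text \<open>The types differ in the value of \<beta> on the first two frame vectors: 0 for
  \<open>cI\<close> and (a - b) e / 2 for \<open>cII e\<close>.\<close>

lemma rank_one_distinct:
  assumes u: "u \<in> U"
  shows "rank_one u cI \<Longrightarrow> rank_one u (cII e) \<Longrightarrow> e = 0"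
    and "rank_one u (cII e) \<Longrightarrow> rank_one u (cII e') \<Longrightarrow> e = e'"
proof -
  obtain X1 where X1: "th1 u X1 = 1 * sqrt (p u)" "th2 u X1 = 0 * sqrt (q u)" "tau u X1 = 0 * (sqrt (p u) * sqrt (q u))"
    using coord_frame[OF u] .
  obtain X2 where X2: "th1 u X2 = 0 * sqrt (p u)" "th2 u X2 = 1 * sqrt (q u)" "tau u X2 = 0 * (sqrt (p u) * sqrt (q u))"
    using coord_frame[OF u] .
  have I: "\<beta> u X1 X2 = 0" if "rank_one u cI"
    using that by (simp add: rank_one_def ell_def cI_def X1)
  have II: "\<beta> u X1 X2 = (a - b) * e / 2" if "rank_one u (cII e)" for e
    using that sqrt_pq[OF u] by (simp add: rank_one_def ell_def cII_def X1 X2)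
  show "rank_one u cI \<Longrightarrow> rank_one u (cII e) \<Longrightarrow> e = 0"
    and "rank_one u (cII e) \<Longrightarrow> rank_one u (cII e') \<Longrightarrow> e = e'"
    using I II[of e] II[of e'] a_neq_b[OF u] by auto
qed

lemma caseII_N:
  assumes u: "u \<in> U" and r: "rank_one u (cII e)"
  defines "w1 \<equiv> (1 / (sqrt 2 * sqrt (p u))) *\<^sub>R cr (f1 u) (n1 u)"
    and "w2 \<equiv> (e / (sqrt 2 * sqrt (q u))) *\<^sub>R cr (f2 u) (n2 u)"
  shows "N1 u X = - b *\<^sub>R F1 u X + tau u X *\<^sub>R f1 u - ((a - b) * ell (cII e) u X) *\<^sub>R w1"
    "N2 u X = - b *\<^sub>R F2 u X - tau u X *\<^sub>R f2 u - ((a - b) * ell (cII e) u X) *\<^sub>R w2"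
proof -
  have "ell (cII e) u Y = lor w1 (F1 u Y) + lor w2 (F2 u Y)" for Y
    unfolding ell_def cII_def w1_def w2_def th1_def th2_def
    by (simp add: lor_simps lor_commute[of "F1 u Y"] lor_commute[of "F2 u Y"])
  then have "\<beta> u X Y = (a - b) * ell (cII e) u X * (lor w1 (F1 u Y) + lor w2 (F2 u Y))" for Y
    using r unfolding rank_one_def by simp
  from N_eq[OF u this] show "N1 u X = - b *\<^sub>R F1 u X + tau u X *\<^sub>R f1 u - ((a - b) * ell (cII e) u X) *\<^sub>R w1"
    "N2 u X = - b *\<^sub>R F2 u X - tau u X *\<^sub>R f2 u - ((a - b) * ell (cII e) u X) *\<^sub>R w2"
    unfolding w1_def w2_def by (simp_all add: lor_simps)
qed

text \<open>In this case the image of \<beta> has no component along \<open>n1\<close>, whence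
  \<langle>n1, dn1\<rangle> = - b tau. The left side is half of dp, so b tau is closed; written out,
  b \<langle>dn1(Z), df1(X)\<rangle> is symmetric, which fails on the first two frame vectors unless
  b (a - b) e = 0.\<close>

lemma caseII_b_zero:
  assumes r: "\<And>u. u \<in> U \<Longrightarrow> rank_one u (cII e)" and e: "e * e = 1" and u: "u \<in> U"
  shows "b = 0"
proof -
  have nN: "lor (n1 v) (N1 v X) = - b * tau v X" if v: "v \<in> U" for v X
    unfolding caseII_N[OF v r[OF v]] using n_tangent[OF v]
    by (simp add: lor_simps tau_def lor_commute[of "n1 v" "f1 v"])
  have s: "lor (n1 u) (NN1 u X Z) + lor (N1 u Z) (N1 u X) + b * (lor (n1 u) (FF1 u X Z) + lor (N1 u Z) (F1 u X)) = 0" for X Z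
    by (rule has_derivative_zero_on_open[OF open_U u _ has_derivative_add[OF lor.FDERIV[OF D1(3)[OF u] D2(3)[OF u]]
        has_derivative_mult_right[OF tau_deriv[OF u]]], where c = 0]) (simp add: nN)
  have sym: "b * lor (N1 u Z) (F1 u X) = b * lor (N1 u X) (F1 u Z)" for X Z
    using s[of X Z, unfolded distrib_left sym2[OF u, of X Z]] s[of Z X, unfolded distrib_left]
      lor_commute[of "N1 u X" "N1 u Z"] by linarith
  obtain Z where Z: "th1 u Z = 1 * sqrt (p u)" "th2 u Z = 0 * sqrt (q u)" "tau u Z = 0 * (sqrt (p u) * sqrt (q u))"
    using coord_frame[OF u] .
  obtain X where X: "th1 u X = 0 * sqrt (p u)" "th2 u X = 1 * sqrt (q u)" "tau u X = 0 * (sqrt (p u) * sqrt (q u))"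
    using coord_frame[OF u] .
  have l: "lor (N1 u V) (F1 u Y) = - b * lor (F1 u V) (F1 u Y) - (a - b) * ell (cII e) u V * (th1 u Y / (sqrt 2 * sqrt (p u)))" for V Y
    unfolding caseII_N[OF u r[OF u]] th1_def
    by (simp add: lor_simps F_tangent[OF u] lor_commute[of "F1 u Y" "cr _ _"])
  have "lor (N1 u Z) (F1 u X) = - b * lor (F1 u Z) (F1 u X)"
    unfolding l by (simp add: X)
  moreover have "lor (N1 u X) (F1 u Z) = - b * lor (F1 u X) (F1 u Z) - (a - b) * e / 2"
    unfolding l using sqrt_pq[OF u] by (simp add: X Z ell_def cII_def)
  ultimately have "b * ((a - b) * e) = 0"
    using sym[of Z X] lor_commute[of "F1 u X" "F1 u Z"] by algebra
  then show ?thesis using e a_neq_b[OF u] by auto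
qed

text \<open>With b = 0 the functions p and q have zero derivative, so \<open>ell\<close> can be
  differentiated easily. Its derivative turns out symmetric on the kernel, which allows the Codazzi
  relation with a vector Y outside the kernel, and there it fails.\<close>

lemma caseII_impossible:
  assumes r: "\<And>u. u \<in> U \<Longrightarrow> rank_one u (cII e)" and e: "e * e = 1" and u: "u \<in> U"
  shows False
proof -
  have b: "b = 0" using caseII_b_zero[OF r e u] .
  note N = caseII_N[OF u r[OF u], unfolded b, simplified]
  have nN: "lor (n1 u) (N1 u X) = 0" "lor (n2 u) (N2 u X) = 0" for X
    unfolding N using n_tangent[OF u]
    by (simp_all add: lor_simps tau_def lor_commute[of "n1 u" "f1 u"] lor_commute[of "n2 u" "f2 u"])
  have dr: "((\<lambda>v. 1 / sqrt (r v)) has_derivative (\<lambda>_. 0)) (at u)"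
    if "(r has_derivative (\<lambda>_. 0)) (at u)" "r u > 0" for r :: "real^3 \<Rightarrow> real"
    using that(2) by (auto intro!: derivative_eq_intros that(1))
  have dp: "((\<lambda>v. 1 / sqrt (p v)) has_derivative (\<lambda>_. 0)) (at u)"
    by (rule dr) (use p_deriv[OF u] nN pq_pos[OF u] in auto)
  have dq: "((\<lambda>v. 1 / sqrt (q v)) has_derivative (\<lambda>_. 0)) (at u)"
    by (rule dr) (use q_deriv[OF u] nN pq_pos[OF u] in auto)
  define T1 where "T1 X Z = lor (F1 u X) (cr (f1 u) (N1 u Z) + cr (F1 u Z) (n1 u))
    + lor (FF1 u X Z) (cr (f1 u) (n1 u))" for X Z
  define T2 where "T2 X Z = lor (F2 u X) (cr (f2 u) (N2 u Z) + cr (F2 u Z) (n2 u))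
    + lor (FF2 u X Z) (cr (f2 u) (n2 u))" for X Z
  define Dl where "Dl X Z = 1 / sqrt 2 * (T1 X Z * (1 / sqrt (p u))) + e / sqrt 2 * (T2 X Z * (1 / sqrt (q u)))" for X Z
  have ell_deriv: "((\<lambda>v. ell (cII e) v X) has_derivative Dl X) (at u)" for X
  proof -
    have "((\<lambda>v. 1 / sqrt 2 * (th1 v X * (1 / sqrt (p v))) + e / sqrt 2 * (th2 v X * (1 / sqrt (q v)))) has_derivative
      (\<lambda>Z. 1 / sqrt 2 * (th1 u X * 0 + T1 X Z * (1 / sqrt (p u))) + e / sqrt 2 * (th2 u X * 0 + T2 X Z * (1 / sqrt (q u))))) (at u)"
      unfolding T1_def T2_def
      by (intro has_derivative_add has_derivative_mult_right has_derivative_mult dp dq th1_deriv[OF u] th2_deriv[OF u])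
    then show ?thesis by (simp add: ell_def cII_def Dl_def[abs_def])
  qed
  have D: "D\<beta> u X Y Z - ((a - b) * (ell (cII e) u X * Dl Y Z + Dl X Z * ell (cII e) u Y)) = 0" for X Y Z
    by (rule has_derivative_zero_on_open[OF open_U u _ has_derivative_diff[OF \<beta>_deriv[OF u]
        has_derivative_mult_right[OF has_derivative_mult[OF ell_deriv ell_deriv]]], where c = 0])
      (use r in \<open>simp add: rank_one_def\<close>)
  define s where "s = sqrt (p u)"
  define t where "t = sqrt (q u)"
  note st = sqrt_pq[OF u, folded s_def t_def]
  \<comment> \<open>X is the third frame vector and Z the first minus e times the second; they span
    the kernel. Y, the first plus e times the second, spans the image.\<close>
  obtain X where X: "th1 u X = 0 * s" "th2 u X = 0 * t" "tau u X = 1 * (s * t)"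
    using coord_frame[OF u, folded s_def t_def] .
  obtain Z where Z: "th1 u Z = 1 * s" "th2 u Z = (- e) * t" "tau u Z = 0 * (s * t)"
    using coord_frame[OF u, folded s_def t_def] .
  obtain Y where Y: "th1 u Y = 1 * s" "th2 u Y = e * t" "tau u Y = 0 * (s * t)"
    using coord_frame[OF u, folded s_def t_def] .
  have ell: "ell (cII e) u X = 0" "ell (cII e) u Z = 0"
    unfolding ell_def cII_def s_def[symmetric] t_def[symmetric] X Z using st e
    by (simp_all add: field_simps)
  have NX: "N1 u X = tau u X *\<^sub>R f1 u" "N2 u X = - tau u X *\<^sub>R f2 u" "N1 u Z = 0" "N2 u Z = 0"
    using N[of X] N[of Z] ell Z by simp_all
  have FX: "F1 u X = (tau u X / p u) *\<^sub>R n1 u" "F2 u X = (- tau u X / q u) *\<^sub>R n2 u"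
    using F1_eq[OF u, of X] F2_eq[OF u, of X] X by simp_all
  \<comment> \<open>The second derivatives are symmetric; the remaining terms vanish because dn
    kills Z, dn(X) is a multiple of the position vectors and df(X) of the normal components.\<close>
  have "T1 X Z = T1 Z X" "T2 X Z = T2 Z X"
    unfolding T1_def T2_def NX FX sym2(1,2)[OF u, of X Z]
    by (simp_all add: lor_simps cr.scaleR_left cr.scaleR_right cr.minus_left cr.minus_right cr.zero_right)
  then have "Dl X Z = Dl Z X" by (simp add: Dl_def)
  then have DD: "D\<beta> u X Y Z = D\<beta> u Z Y X" using D[of X Y Z] D[of Z Y X] ell by simp
  have ker: "\<beta> u X V = 0" "\<beta> u Z V = 0" for V
    using r[OF u] ell by (simp_all add: rank_one_def)
  have "tau u X * gP u Y Z = 0" using codazzi[OF u ker DD] Z by simp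
  moreover have "gP u Y Z = 2"
    unfolding gP_coord[OF u] Y Z st(1,2)[symmetric] using st(3,4) e by simp
  ultimately show False using X st by simp
qed

lemma rank_one_cI:
  assumes u: "u \<in> U"
  shows "rank_one u cI"
proof -
  have False if r: "rank_one u (cII e)" and e: "e = 1 \<or> e = -1" for e
  proof -
    \<comment> \<open>On this open neighbourhood of u the other two types fail, so type
      \<open>cII e\<close> holds throughout it.\<close>
    define V where "V = {v \<in> U. \<not> rank_one v cI} \<inter> {v \<in> U. \<not> rank_one v (cII (- e))}"
    have V: "open V" "V \<subseteq> U" using open_not_rank_one by (auto simp: V_def)
    have "u \<in> V" using rank_one_distinct[OF u] r u e unfolding V_def by fastforce
    moreover have "rank_one v (cII e)" if "v \<in> V" for v
      using rank_one_cases[of v] that e by (auto simp: V_def)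
    ultimately show False
      using nondegenerate.caseII_impossible[OF restrict_nondegenerate[OF V]] e by fastforce
  qed
  then show ?thesis using rank_one_cases[OF u] by blast
qed

section \<open>Consequences of the image direction \<open>cI\<close>\<close>

lemma N1_eq:
  assumes u: "u \<in> U"
  shows "N1 u X = - b *\<^sub>R F1 u X + tau u X *\<^sub>R f1 u - ((a - b) * tau u X / p u) *\<^sub>R n1 u"
proof -
  define s where "s = sqrt (p u)"
  define t where "t = sqrt (q u)"
  note st = sqrt_pq[OF u, folded s_def t_def]
  \<comment> \<open>The image of \<beta> is spanned by \<open>(q n\<^sub>1, - p n\<^sub>2)\<close>,
    whose product with the image of Y is (p + q) tau(Y) = tau(Y).\<close>
  have "\<beta> u X Y = (a - b) * tau u X / (p u * q u) * (lor (q u *\<^sub>R n1 u) (F1 u Y) + lor (- p u *\<^sub>R n2 u) (F2 u Y))" for Y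
  proof -
    have "\<beta> u X Y = (a - b) * (tau u X / (s * t)) * (tau u Y / (s * t))"
      using rank_one_cI[OF u] by (simp add: rank_one_def ell_def cI_def s_def t_def)
    also have "\<dots> = (a - b) * tau u X / (p u * q u) * tau u Y"
      unfolding st(1,2)[symmetric] by simp
    also have "tau u Y = (p u + q u) * tau u Y" using pq_pos(3)[OF u] by simp
    finally show ?thesis using n2_F2[OF u, of Y] by (simp add: lor_simps tau_def[of u Y] distrib_right add.commute)
  qed
  from N_eq(1)[OF u this] show ?thesis
    using pq_pos[OF u] n_tangent[OF u] by (simp add: lor_simps p_def q_def)
qed

lemma n1_N1: "u \<in> U \<Longrightarrow> lor (n1 u) (N1 u X) = - a * tau u X"
  using n_tangent(1)[of u] pq_pos[of u]
  by (simp add: N1_eq lor_simps tau_def[symmetric] p_def[symmetric] lor_commute[of "n1 u" "f1 u"]) (simp_all add: algebra_simps)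

lemma p_value:
  assumes u: "u \<in> U"
  shows "p u = - (a - b) * b"
proof -
  define s where "s = sqrt (p u)"
  define t where "t = sqrt (q u)"
  note st = sqrt_pq[OF u, folded s_def t_def]
  obtain X where X: "th1 u X = 0 * s" "th2 u X = 0 * t" "tau u X = 1 * (s * t)"
    using coord_frame[OF u, folded s_def t_def] .
  obtain Z where Z: "th1 u Z = 1 * s" "th2 u Z = 0 * t" "tau u Z = 0 * (s * t)"
    using coord_frame[OF u, folded s_def t_def] .
  define T where "T X Z = lor (n1 u) (FF1 u X Z) + lor (N1 u Z) (F1 u X)" for X Z
  \<comment> \<open>\<open>N1_eq\<close>, multiplied by p to clear the denominator, is
    differentiated. Exchanging X and Z cancels the second derivatives and the derivative of tau,
    which leaves tau(X) (p + (a - b) b) df1(Z) = 0.\<close>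
  have D: "(p u *\<^sub>R NN1 u X Z + (2 * lor (n1 u) (N1 u Z)) *\<^sub>R N1 u X)
     + b *\<^sub>R (p u *\<^sub>R FF1 u X Z + (2 * lor (n1 u) (N1 u Z)) *\<^sub>R F1 u X)
     - ((p u * tau u X) *\<^sub>R F1 u Z + (p u * T X Z + 2 * lor (n1 u) (N1 u Z) * tau u X) *\<^sub>R f1 u)
     + (a - b) *\<^sub>R (tau u X *\<^sub>R N1 u Z + T X Z *\<^sub>R n1 u) = 0" for X Z
  proof -
    have der: "((\<lambda>v. p v *\<^sub>R N1 v X + b *\<^sub>R (p v *\<^sub>R F1 v X) - (p v * tau v X) *\<^sub>R f1 v + (a - b) *\<^sub>R (tau v X *\<^sub>R n1 v))
      has_derivative (\<lambda>Z. (p u *\<^sub>R NN1 u X Z + (2 * lor (n1 u) (N1 u Z)) *\<^sub>R N1 u X)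
     + b *\<^sub>R (p u *\<^sub>R FF1 u X Z + (2 * lor (n1 u) (N1 u Z)) *\<^sub>R F1 u X)
     - ((p u * tau u X) *\<^sub>R F1 u Z + (p u * T X Z + 2 * lor (n1 u) (N1 u Z) * tau u X) *\<^sub>R f1 u)
     + (a - b) *\<^sub>R (tau u X *\<^sub>R N1 u Z + T X Z *\<^sub>R n1 u))) (at u)"
      unfolding T_def
      by (intro has_derivative_add has_derivative_diff has_derivative_scaleR_right has_derivative_scaleR has_derivative_mult
          p_deriv[OF u] tau_deriv[OF u] D1[OF u] D2[OF u])
    have z: "p v *\<^sub>R N1 v X + b *\<^sub>R (p v *\<^sub>R F1 v X) - (p v * tau v X) *\<^sub>R f1 v + (a - b) *\<^sub>R (tau v X *\<^sub>R n1 v) = 0"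
      if "v \<in> U" for v
      using pq_pos[OF that] unfolding N1_eq[OF that] by (simp add: scaleR_right_distrib scaleR_right_diff_distrib ac_simps)
    show ?thesis by (rule has_derivative_zero_on_open[OF open_U u z der])
  qed
  have NZ: "N1 u Z = - b *\<^sub>R F1 u Z" using N1_eq[OF u, of Z] Z by simp
  have nZ: "lor (n1 u) (N1 u Z) = 0" using n1_N1[OF u] Z by simp
  have TT: "T X Z = T Z X"
    unfolding T_def NZ N1_eq[OF u, of X] sym2(1)[OF u, of X Z]
    using Z by (simp add: lor_simps F_tangent[OF u] tau_def lor_commute[of "F1 u X" "F1 u Z"])
  have "(tau u X * (p u + (a - b) * b)) *\<^sub>R F1 u Z = 0"
  proof -
    have 1: "(p u *\<^sub>R NN1 u X Z + b *\<^sub>R (p u *\<^sub>R FF1 u X Z) - (p u * T X Z) *\<^sub>R f1 u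
       + (a - b) *\<^sub>R (T X Z *\<^sub>R n1 u)) - (p u * tau u X) *\<^sub>R F1 u Z = ((a - b) * tau u X * b) *\<^sub>R F1 u Z"
      using D[of X Z, unfolded nZ, unfolded NZ] by (simp add: algebra_simps)
    have 2: "p u *\<^sub>R NN1 u X Z + b *\<^sub>R (p u *\<^sub>R FF1 u X Z) - (p u * T X Z) *\<^sub>R f1 u
       + (a - b) *\<^sub>R (T X Z *\<^sub>R n1 u) = 0"
      using D[of Z X] unfolding NZ TT[symmetric] sym2(1)[OF u, of Z X] sym2(3)[OF u, of Z X] using Z by (simp add: algebra_simps)
    have "(p u * tau u X) *\<^sub>R F1 u Z + ((a - b) * tau u X * b) *\<^sub>R F1 u Z = 0"
      unfolding 1[unfolded 2, symmetric] by simp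
    then show ?thesis by (simp only: scaleR_left_distrib[symmetric]) (simp add: algebra_simps)
  qed
  moreover have "F1 u Z \<noteq> 0" using Z st by (auto simp: th1_def lor_simps)
  moreover have "tau u X \<noteq> 0" using X st by simp
  ultimately have "p u + (a - b) * b = 0" by simp
  then show ?thesis by (simp add: algebra_simps)
qed

end

text \<open>Exchanging the factors gives q the same value as p, so both are 1/2. Then p is constant,
  and its derivative - 2 a tau forces a = 0.\<close>

lemma (in nondegenerate) normal_form:
  assumes u: "u \<in> U"
  shows "p u = 1 / 2" "2 * b * b = 1"
    "N1 u X = - b *\<^sub>R F1 u X + tau u X *\<^sub>R (f1 u + (2 * b) *\<^sub>R n1 u)"
    "N2 u X = - b *\<^sub>R F2 u X - tau u X *\<^sub>R (f2 u + (2 * b) *\<^sub>R n2 u)"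
proof -
  interpret S: nondegenerate U f2 f1 n2 n1 a b by (rule swapped_nondegenerate)
  have Sp: "S.p v = q v" for v by (simp add: S.p_def q_def)
  have q: "q u = - (a - b) * b" using S.p_value[OF u] Sp by simp
  then have p: "p v = 1 / 2" if "v \<in> U" for v
    using p_value[OF that] p_value[OF u] pq_pos(3)[OF u] by linarith
  have db: "(a - b) * b = - 1 / 2" and qh: "q u = 1 / 2" using p_value[OF u] p[OF u] q by (auto simp: algebra_simps)
  obtain Y where Y: "th1 u Y = 0" "th2 u Y = 0" "tau u Y = 1" using coord_surj[OF u] .
  have "2 * lor (n1 u) (N1 u Y) = 0"
    by (rule has_derivative_zero_on_open[OF open_U u p p_deriv[OF u]])
  then have a: "a = 0" using n1_N1[OF u, of Y] Y by simp
  show "p u = 1 / 2" by (rule p[OF u])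
  show "2 * b * b = 1" using db a by simp
  show "N1 u X = - b *\<^sub>R F1 u X + tau u X *\<^sub>R (f1 u + (2 * b) *\<^sub>R n1 u)"
    using N1_eq[OF u, of X] p[OF u] a by (simp add: algebra_simps)
  have "S.tau u X = - tau u X" using n2_F2[OF u, of X] by (simp add: S.tau_def)
  then show "N2 u X = - b *\<^sub>R F2 u X - tau u X *\<^sub>R (f2 u + (2 * b) *\<^sub>R n2 u)"
    using S.N1_eq[OF u, of X] Sp[of u] qh a by (simp add: algebra_simps)
qed

section \<open>Curves of constant curvature and invariance of domain\<close>

text \<open>With \<open>\<delta> = 1 - \<kappa>\<^sup>2\<close>, the curve \<open>x\<^sub>0 + S t + D (x\<^sub>0 + \<kappa> n)\<close> solves \<open>r'' = \<delta> r + \<kappa> c\<close>, the equation of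
  constant curvature \<open>\<kappa>\<close>; the sign of \<open>\<delta>\<close> separates equidistants, horocycles and circles.\<close>

lemma const_curvature_profile:
  fixes \<delta> :: real
  shows "\<exists>S D :: real \<Rightarrow> real.
    (\<forall>s. (S has_real_derivative 1 + \<delta> * D s) (at s)) \<and> (\<forall>s. (D has_real_derivative S s) (at s)) \<and>
    (\<forall>s. (S s)^2 = 2 * D s + \<delta> * (D s)^2) \<and> (\<forall>s. D s \<ge> 0) \<and> (\<forall>s. S (- s) = - S s \<and> D (- s) = D s) \<and>
    (\<forall>d\<ge>0. 2 * d + \<delta> * d^2 \<ge> 0 \<longrightarrow> (\<exists>s. D s = d))"
proof -
  consider "\<delta> = 0" | "\<delta> > 0" | "\<delta> < 0" by linarith
  then show ?thesis
  proof cases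
    case 1
    have "\<exists>s. s^2 / 2 = d" if "d \<ge> 0" for d :: real
      using that by (intro exI[of _ "sqrt (2 * d)"]) simp
    then show ?thesis
      using 1 by (intro exI[of _ "\<lambda>s. s"] exI[of _ "\<lambda>s. s^2 / 2"]) (auto intro!: derivative_eq_intros)
  next
    case 2
    define w where "w = sqrt \<delta>"
    have w: "w > 0" "\<delta> = w^2" using 2 by (auto simp: w_def)
    have sq: "(sinh (w * s) / w)^2 = 2 * ((cosh (w * s) - 1) / w^2) + w^2 * ((cosh (w * s) - 1) / w^2)^2" for s
    proof -
      have "(sinh (w * s) / w)^2 = (cosh (w * s)^2 - 1) / w^2"
        by (simp add: power_divide cosh_square_eq)
      also have "\<dots> = 2 * ((cosh (w * s) - 1) / w^2) + w^2 * ((cosh (w * s) - 1) / w^2)^2"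
        using w by (simp add: field_simps power2_eq_square)
      finally show ?thesis .
    qed
    have surj: "\<exists>s. (cosh (w * s) - 1) / w^2 = d" if "d \<ge> 0" for d
      using that w by (intro exI[of _ "arcosh (1 + w^2 * d) / w"]) simp
    have D1: "((\<lambda>s. sinh (w * s) / w) has_real_derivative cosh (w * s)) (at s)"
      "((\<lambda>s. (cosh (w * s) - 1) / w^2) has_real_derivative sinh (w * s) / w) (at s)" for s
      using w by (auto intro!: derivative_eq_intros simp: power2_eq_square field_simps)
    show ?thesis
      unfolding w(2) using w(1) sq surj D1
      by (intro exI[of _ "\<lambda>s. sinh (w * s) / w"] exI[of _ "\<lambda>s. (cosh (w * s) - 1) / w^2"])
        (simp add: cosh_real_ge_1)
  next
    case 3
    define w where "w = sqrt (- \<delta>)"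
    have w: "w > 0" "\<delta> = - (w^2)" using 3 by (auto simp: w_def)
    have sq: "(sin (w * s) / w)^2 = 2 * ((1 - cos (w * s)) / w^2) - w^2 * ((1 - cos (w * s)) / w^2)^2" for s
    proof -
      have "(sin (w * s) / w)^2 = (1 - cos (w * s)^2) / w^2"
        by (simp add: power_divide sin_squared_eq)
      also have "\<dots> = 2 * ((1 - cos (w * s)) / w^2) - w^2 * ((1 - cos (w * s)) / w^2)^2"
        using w by (simp add: field_simps power2_eq_square)
      finally show ?thesis .
    qed
    have surj: "\<exists>s. (1 - cos (w * s)) / w^2 = d" if "d \<ge> 0" "2 * d - w^2 * d^2 \<ge> 0" for d
    proof -
      \<comment> \<open>The sign condition bounds d by \<open>2 / w^2\<close>, the maximum of the
        cosine profile.\<close>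
      have "d * (2 - w^2 * d) \<ge> 0" using that(2) by (simp add: power2_eq_square algebra_simps)
      then have "d = 0 \<or> 2 - w^2 * d \<ge> 0" using that(1) by (auto simp: zero_le_mult_iff)
      then have "1 - w^2 * d \<ge> -1" by auto
      moreover have "1 - w^2 * d \<le> 1" using that by simp
      ultimately have "cos (arccos (1 - w^2 * d)) = 1 - w^2 * d" by (rule cos_arccos)
      then show ?thesis using w by (intro exI[of _ "arccos (1 - w^2 * d) / w"]) simp
    qed
    have D1: "((\<lambda>s. sin (w * s) / w) has_real_derivative cos (w * s)) (at s)"
      "((\<lambda>s. (1 - cos (w * s)) / w^2) has_real_derivative sin (w * s) / w) (at s)" for s
      using w by (auto intro!: derivative_eq_intros simp: power2_eq_square field_simps)
    show ?thesis
      unfolding w(2) using w(1) sq surj D1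
      by (intro exI[of _ "\<lambda>s. sin (w * s) / w"] exI[of _ "\<lambda>s. (1 - cos (w * s)) / w^2"]) simp
  qed
qed

lemma Cinf_on_profile_curve:
  fixes A B C :: "'b::real_normed_vector"
  assumes S: "\<And>s. (S has_real_derivative 1 + \<delta> * D s) (at s)" and D: "\<And>s. (D has_real_derivative S s) (at s)"
  shows "Cinf_on UNIV (\<lambda>s::real. A + S s *\<^sub>R B + D s *\<^sub>R C)"
proof -
  \<comment> \<open>These combinations with varying coefficients are closed under differentiation,
    since S' = 1 + \<delta> D and D' = S.\<close>
  define R where "R g \<longleftrightarrow> (\<exists>A B C. g = (\<lambda>s. A + S s *\<^sub>R B + D s *\<^sub>R C))" for g :: "real \<Rightarrow> 'b"
  have "R (\<lambda>s. A + S s *\<^sub>R B + D s *\<^sub>R C)" unfolding R_def by blast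
  then show ?thesis
  proof (rule Cinf_on.coinduct[where X = R])
    fix g assume "R g"
    then obtain A B C where g: "g = (\<lambda>s. A + S s *\<^sub>R B + D s *\<^sub>R C)" unfolding R_def by blast
    have d: "(g has_derivative (\<lambda>v. v *\<^sub>R ((1 + \<delta> * D s) *\<^sub>R B + S s *\<^sub>R C))) (at s)" for s
      unfolding g
      by (rule has_derivative_eq_rhs, (rule derivative_intros S[THEN has_field_derivative_imp_has_derivative] D[THEN has_field_derivative_imp_has_derivative])+)
        (auto simp: algebra_simps)
    have "(\<lambda>s. fderiv g s v) = (\<lambda>s. v *\<^sub>R B + S s *\<^sub>R (v *\<^sub>R C) + D s *\<^sub>R ((v * \<delta>) *\<^sub>R B))" for v
      using fderiv_eq[OF d] by (auto simp: fun_eq_iff algebra_simps)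
    then have "R (\<lambda>s. fderiv g s v)" for v unfolding R_def by blast
    moreover have "g differentiable_on UNIV"
      using d by (auto simp: differentiable_on_def differentiable_def)
    ultimately show "\<exists>f. g = f \<and> f differentiable_on UNIV \<and> (\<forall>v. R (\<lambda>x. fderiv f x v) \<or> Cinf_on UNIV (\<lambda>x. fderiv f x v))"
      by blast
  qed
qed

section \<open>Level curves of linear functionals as curves of constant curvature\<close>

locale level_curve =
  fixes x0 c :: "real^3" and \<kappa> :: real
  assumes x0: "x0 \<in> H2" "lor x0 c = - \<kappa>" and c: "lor c c = 1 - \<kappa>^2"
begin

text \<open>At the base point \<open>x0\<close> of the level curve, \<open>n\<close> is the unit
  normal, \<open>t\<close> the unit tangent and \<open>v\<close> the ambient acceleration of the
  unit speed curve.\<close>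

definition n where "n = c - \<kappa> *\<^sub>R x0"
definition t where "t = cr x0 n"
definition v where "v = x0 + \<kappa> *\<^sub>R n"
definition \<Gamma> where "\<Gamma> = {x \<in> H2. lor x c = - \<kappa>}"

lemma frame: "lor x0 x0 = -1" "lor x0 n = 0" "lor n n = 1"
  using x0 c H2_lor[OF x0(1)] by (simp_all add: n_def lor_simps lor_commute[of c x0] power2_eq_square)

lemma t_unit: "lor t t = 1" "lor t x0 = 0" "lor t n = 0" "lor x0 t = 0" "lor n t = 0"
  unfolding t_def using lor_cr_self[OF frame(1,2)] frame(3) by simp_all

lemma lor_c: "lor y c = lor y n + \<kappa> * lor y x0" by (simp add: n_def lor_simps)

text \<open>The number d is the hyperbolic cosine of the distance to \<open>x0\<close>, minus one.
  The level condition gives \<open>lor x n = \<kappa> * d\<close>, and the equation of the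
  hyperboloid becomes the relation satisfied by S and D.\<close>

lemma decompose:
  assumes x: "x \<in> \<Gamma>"
  defines "d \<equiv> - lor x x0 - 1"
  shows "x = x0 + lor x t *\<^sub>R t + d *\<^sub>R v" "(lor x t)^2 = 2 * d + (1 - \<kappa>^2) * d^2" "d \<ge> 0"
proof -
  have xn: "lor x n = \<kappa> * d"
    using x by (simp add: n_def lor_simps \<Gamma>_def d_def algebra_simps)
  have "x = - lor x x0 *\<^sub>R x0 + lor x n *\<^sub>R n + lor x t *\<^sub>R t"
    using frame_expand[OF frame(1,2), of x] frame(3) by (simp add: t_def)
  also have "- lor x x0 = 1 + d" by (simp add: d_def)
  finally show "x = x0 + lor x t *\<^sub>R t + d *\<^sub>R v"
    unfolding xn by (simp add: v_def algebra_simps)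
  have "-1 = - ((1 + d)^2) + (\<kappa> * d)^2 + (lor x t)^2"
    using lor_parseval[OF frame, of x x] x xn
    by (simp add: \<Gamma>_def H2_lor t_def d_def power2_eq_square)
  then show "(lor x t)^2 = 2 * d + (1 - \<kappa>^2) * d^2"
    by (simp add: power2_eq_square algebra_simps)
  show "d \<ge> 0"
    using H2_lor_less(1)[OF x0(1), of x] x by (simp add: \<Gamma>_def H2_def d_def lor_commute)
qed

lemma const_curv: "const_curv_curve \<Gamma>"
proof -
  define \<delta> where "\<delta> = 1 - \<kappa>^2"
  obtain S D where S: "\<And>s. (S has_real_derivative 1 + \<delta> * D s) (at s)"
    and D: "\<And>s. (D has_real_derivative S s) (at s)"
    and sq: "\<And>s. (S s)^2 = 2 * D s + \<delta> * (D s)^2" and pos: "\<And>s. D s \<ge> 0"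
    and odd: "\<And>s. S (- s) = - S s" "\<And>s. D (- s) = D s"
    and surj: "\<And>d. d \<ge> 0 \<Longrightarrow> 2 * d + \<delta> * d^2 \<ge> 0 \<Longrightarrow> \<exists>s. D s = d"
    using const_curvature_profile[of \<delta>] by blast
  define r where "r s = x0 + S s *\<^sub>R t + D s *\<^sub>R v" for s
  define r' where "r' s = (1 + \<delta> * D s) *\<^sub>R t + S s *\<^sub>R v" for s
  have dr: "(r has_vector_derivative r' s) (at s)" for s
    unfolding r_def[abs_def] r'_def
    by (rule has_vector_derivative_eq_rhs) (auto intro!: derivative_eq_intros S D)
  have dr': "(r' has_vector_derivative (\<delta> * S s) *\<^sub>R t + (1 + \<delta> * D s) *\<^sub>R v) (at s)" for s
    unfolding r'_def[abs_def]
    by (rule has_vector_derivative_eq_rhs) (auto intro!: derivative_eq_intros S D)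
  have vr: "vector_derivative r (at s) = r' s" for s by (rule vector_derivative_at[OF dr])
  have vr': "vector_derivative r' (at s) = (\<delta> * S s) *\<^sub>R t + (1 + \<delta> * D s) *\<^sub>R v" for s
    by (rule vector_derivative_at[OF dr'])
  have vv: "lor v v = - \<delta>" "lor x0 v = -1" "lor v x0 = -1" "lor t v = 0" "lor v t = 0"
    unfolding v_def \<delta>_def using frame t_unit
    by (simp_all add: lor_simps lor_commute[of n x0] power2_eq_square)
  have vc: "lor v c = 0" "lor t c = 0" "lor x0 c = - \<kappa>"
    unfolding lor_c v_def using frame t_unit by (simp_all add: lor_simps lor_commute[of n x0])
  have rr: "lor (r s) (r s) = -1" for s
  proof -
    have "lor (r s) (r s) = -1 + (S s)^2 - \<delta> * (D s)^2 - 2 * D s"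
      unfolding r_def using frame t_unit vv by (simp add: lor_simps power2_eq_square algebra_simps)
    then show ?thesis using sq[of s] by simp
  qed
  have rx0: "lor x0 (r s) = -1 - D s" for s
    unfolding r_def using frame t_unit vv by (simp add: lor_simps)
  have rH: "r s \<in> H2" for s
    using rr[of s] rx0[of s] pos[of s] H2_lor_less(2)[OF x0(1) rr[of s]] by (simp add: H2_def)
  have rc: "lor (r s) c = - \<kappa>" for s
    unfolding r_def using vc by (simp add: lor_simps)
  have r'r': "lor (r' s) (r' s) = 1" for s
  proof -
    have "lor (r' s) (r' s) = (1 + \<delta> * D s)^2 - \<delta> * (S s)^2"
      unfolding r'_def using t_unit vv by (simp add: lor_simps power2_eq_square)
    then show ?thesis unfolding sq by (simp add: power2_eq_square algebra_simps)
  qed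
  have r'c: "lor (r' s) c = 0" for s unfolding r'_def using vc by (simp add: lor_simps)
  have r'r: "lor (r' s) (r s) = 0" for s
    unfolding r_def r'_def using t_unit vv by (simp add: lor_simps algebra_simps)
  define \<nu> where "\<nu> s = c - \<kappa> *\<^sub>R r s" for s
  have \<nu>: "lor (r s) (\<nu> s) = 0" "lor (r' s) (\<nu> s) = 0" "lor (\<nu> s) (\<nu> s) = 1" for s
    unfolding \<nu>_def using rr[of s] rc[of s] r'c[of s] r'r[of s] c
    by (simp_all add: lor_simps lor_commute[of c "r s"] power2_eq_square)
  have acc: "vector_derivative r' (at s) - r s = \<kappa> *\<^sub>R \<nu> s" for s
    unfolding vr' \<nu>_def r_def v_def n_def \<delta>_def by (simp add: algebra_simps power2_eq_square)
  have img: "\<Gamma> = range r"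
  proof
    show "range r \<subseteq> \<Gamma>" using rH rc by (auto simp: \<Gamma>_def)
    show "\<Gamma> \<subseteq> range r"
    proof
      fix x assume x: "x \<in> \<Gamma>"
      note d = decompose[OF x, folded \<delta>_def]
      \<comment> \<open>Choosing s with D s = d fixes S s up to sign; since S is odd and D even, s
        or - s is the right parameter.\<close>
      obtain s where s: "D s = - lor x x0 - 1" using surj[OF d(3)] d(2) by (metis zero_le_power2)
      have "(S s)^2 = (lor x t)^2" unfolding sq s d(2) ..
      then have "S s = lor x t \<or> S s = - lor x t" using power2_eq_iff by blast
      then have "r s = x \<or> r (- s) = x"
        using d(1) by (auto simp: r_def odd s)
      then show "x \<in> range r" by blast
    qed
  qed
  have "Cinf_on UNIV r" unfolding r_def[abs_def] by (rule Cinf_on_profile_curve[OF S D])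
  moreover have "continuous_on UNIV \<nu>"
    unfolding \<nu>_def[abs_def] using Cinf_on_continuous_on[OF \<open>Cinf_on UNIV r\<close>] by (intro continuous_intros)
  ultimately show ?thesis
    unfolding const_curv_curve_def
    by (intro exI[of _ UNIV] exI[of _ r] exI[of _ \<nu>] exI[of _ \<kappa>])
      (simp add: img rH vr r'r' \<nu> acc is_interval_univ)
qed

text \<open>The map from d to \<open>2 * d + (1 - \<kappa>^2) * d^2\<close> is injective where half
  its derivative is positive, so there the t-coordinate determines d and with it the point.\<close>

lemma inj_local:
  "inj_on (\<lambda>x. lor x t) {x \<in> \<Gamma>. 1 + (1 - \<kappa>^2) * (- lor x x0 - 1) > 0}"
proof (rule inj_onI)
  fix x y assume x: "x \<in> {x \<in> \<Gamma>. 1 + (1 - \<kappa>^2) * (- lor x x0 - 1) > 0}"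
    and y: "y \<in> {x \<in> \<Gamma>. 1 + (1 - \<kappa>^2) * (- lor x x0 - 1) > 0}" and e: "lor x t = lor y t"
  define d d' where "d = - lor x x0 - 1" and "d' = - lor y x0 - 1"
  note dx = decompose[of x, folded d_def] and dy = decompose[of y, folded d'_def]
  have "2 * d + (1 - \<kappa>^2) * d^2 = 2 * d' + (1 - \<kappa>^2) * d'^2"
    using dx(2) dy(2) x y e by simp
  then have "(d - d') * ((1 + (1 - \<kappa>^2) * d) + (1 + (1 - \<kappa>^2) * d')) = 0"
    by (simp add: power2_eq_square algebra_simps)
  moreover have "1 + (1 - \<kappa>^2) * d > 0" "1 + (1 - \<kappa>^2) * d' > 0"
    using x y by (auto simp: d_def d'_def)
  ultimately have "d = d'" by auto
  then show "x = y" using dx(1) dy(1) x y e by auto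
qed

end

section \<open>Relative openness from parametrisations\<close>

lemma H2_eqI: "x \<in> H2 \<Longrightarrow> y \<in> H2 \<Longrightarrow> x$2 = y$2 \<Longrightarrow> x$3 = y$3 \<Longrightarrow> x = y"
proof -
  assume h: "x \<in> H2" "y \<in> H2" "x$2 = y$2" "x$3 = y$3"
  then have "(x$1)^2 = (y$1)^2" "x$1 > 0" "y$1 > 0"
    by (auto simp: H2_def lor_def power2_eq_square)
  then have "x$1 = y$1" by (simp add: power2_eq_iff_nonneg)
  then show "x = y" using h by (simp add: vec_eq_iff forall_3)
qed

text \<open>A parametrisation of M followed by a local coordinate map of T is an injective
  continuous map between open sets of the same dimension or onto its image there, hence
  open.\<close>

lemma openin_by_invariance_of_domain:
  fixes T :: "'a::t2_space set"
  assumes sub: "M \<subseteq> T"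
    and M: "\<And>x. x \<in> M \<Longrightarrow> \<exists>U f. open U \<and> continuous_on U f \<and> inj_on f U \<and> f ` U \<subseteq> M \<and> x \<in> f ` (U::'b::euclidean_space set)"
    and T: "\<And>x. x \<in> M \<Longrightarrow> \<exists>W \<Theta>. open W \<and> x \<in> W \<and> continuous_on (T \<inter> W) \<Theta> \<and> inj_on (\<Theta> :: 'a \<Rightarrow> 'b) (T \<inter> W)"
  shows "openin (top_of_set T) M"
proof (subst openin_subopen, safe)
  fix x assume x: "x \<in> M"
  obtain U f where U: "open U" "continuous_on U f" "inj_on f U" "f ` U \<subseteq> M" "x \<in> f ` (U::'b set)"
    using M[OF x] by blast
  obtain W and \<Theta> :: "'a \<Rightarrow> 'b" where W: "open W" "x \<in> W" "continuous_on (T \<inter> W) \<Theta>" "inj_on \<Theta> (T \<inter> W)"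
    using T[OF x] by blast
  define V where "V = U \<inter> f -` W"
  have V: "open V" unfolding V_def using U(1,2) W(1) by (simp add: continuous_open_preimage)
  have fV: "f ` V \<subseteq> T \<inter> W" using U(4) sub by (auto simp: V_def)
  have "continuous_on V (\<Theta> \<circ> f)"
    using continuous_on_subset[OF U(2)] continuous_on_subset[OF W(3) fV]
    by (intro continuous_on_compose) (auto simp: V_def)
  moreover have "inj_on (\<Theta> \<circ> f) V"
    using inj_on_subset[OF U(3)] inj_on_subset[OF W(4) fV] by (intro comp_inj_on) (auto simp: V_def)
  ultimately have O: "open ((\<Theta> \<circ> f) ` V)" using V by (intro invariance_of_domain)
  \<comment> \<open>All points of T near x whose coordinates are attained on M; injectivity of the
    coordinates puts them into M.\<close>
  define S where "S = (T \<inter> W) \<inter> \<Theta> -` ((\<Theta> \<circ> f) ` V)"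
  have "openin (top_of_set (T \<inter> W)) S"
    unfolding S_def by (rule continuous_openin_preimage_gen[OF W(3) O])
  then have "openin (top_of_set T) S"
    using W(1) by (metis openin_open_Int openin_trans)
  moreover have "x \<in> S" using U(5) W(2) x sub unfolding S_def V_def by auto
  moreover have "S \<subseteq> M"
  proof
    fix y assume "y \<in> S"
    then obtain z where z: "y \<in> T \<inter> W" "z \<in> V" "\<Theta> y = \<Theta> (f z)" unfolding S_def by auto
    then have "y = f z" using W(4) fV by (auto dest: inj_onD)
    then show "y \<in> M" using z(2) U(4) by (auto simp: V_def)
  qed
  ultimately show "\<exists>S. openin (top_of_set T) S \<and> x \<in> S \<and> S \<subseteq> M" by blast
qed

section \<open>Isometries and global arguments\<close>

lemma Cinf_on_bounded_linear:
  assumes "bounded_linear L"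
  shows "Cinf_on U L"
proof -
  \<comment> \<open>Affine maps: their directional derivatives are constant, hence affine
    again.\<close>
  define R where "R g \<longleftrightarrow> (\<exists>L c. bounded_linear L \<and> g = (\<lambda>x. L x + c))" for g :: "'a \<Rightarrow> 'b"
  have "R L" unfolding R_def using assms by (intro exI[of _ L] exI[of _ 0]) auto
  then show ?thesis
  proof (rule Cinf_on.coinduct[where X = R])
    fix g assume "R g"
    then obtain L c where g: "bounded_linear L" "g = (\<lambda>x. L x + c)" unfolding R_def by blast
    have d: "(g has_derivative L) F" for F
      unfolding g(2) using bounded_linear_imp_has_derivative[OF g(1)] has_derivative_const by (auto intro!: derivative_eq_intros)
    have "R (\<lambda>x. fderiv g x v)" for v
      unfolding R_def fderiv_eq[OF d] by (intro exI[of _ "\<lambda>_. 0"] exI[of _ "L v"]) (simp add: bounded_linear_zero)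
    then show "\<exists>f. g = f \<and> f differentiable_on U \<and> (\<forall>v. R (\<lambda>x. fderiv f x v) \<or> Cinf_on U (\<lambda>x. fderiv f x v))"
      using d by (auto simp: differentiable_on_def differentiable_def)
  qed
qed

lemma isometry_HH_linear:
  assumes "linear \<Phi>" "bij_betw \<Phi> HH HH" "\<And>v w. G (\<Phi> v) (\<Phi> w) = G v w"
  shows "isometry_HH \<Phi>"
proof -
  have L: "bounded_linear \<Phi>" using assms(1) by (simp add: linear_conv_bounded_linear)
  have "fderiv \<Phi> x v = \<Phi> v" for x v
    by (rule fderiv_eq[OF bounded_linear_imp_has_derivative[OF L]])
  then show ?thesis
    unfolding isometry_HH_def using assms(2,3) Cinf_on_bounded_linear[OF L, of UNIV] by auto
qed

lemma isometry_HH_swap: "isometry_HH prod.swap"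
proof (rule isometry_HH_linear)
  show "bij_betw prod.swap HH HH"
    by (rule bij_betw_byWitness[where f' = prod.swap]) (auto simp: HH_def)
qed (auto intro!: linearI simp: G_def)

text \<open>Coordinates in the orthonormal frame \<open>x0, cr x0 n, n\<close>, ordered so that the
  null vector \<open>x0 + n\<close> goes to \<open>vector [1, 0, 1]\<close>.\<close>

definition lorentz_frame :: "real^3 \<Rightarrow> real^3 \<Rightarrow> real^3 \<Rightarrow> real^3" where
  "lorentz_frame x0 n x = vector [- lor x x0, lor x (cr x0 n), lor x n]"

lemma lorentz_frame:
  assumes x0: "x0 \<in> H2" and n: "lor x0 n = 0" "lor n n = 1"
  shows "linear (lorentz_frame x0 n)"
    and "lor (lorentz_frame x0 n x) (lorentz_frame x0 n y) = lor x y"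
    and "bij_betw (lorentz_frame x0 n) H2 H2"
    and "lor (lorentz_frame x0 n x) (vector [1, 0, 1]) = lor x (x0 + n)"
proof -
  let ?A = "lorentz_frame x0 n" and ?t = "cr x0 n"
  note x0' = H2_lor[OF x0]
  show "linear ?A"
    by (rule linearI) (simp_all add: lorentz_frame_def vec_eq_iff forall_3 lor_simps)
  show iso: "lor (?A x) (?A y) = lor x y" for x y
    unfolding lor_parseval[OF x0' n, of x y] by (simp add: lorentz_frame_def lor_def[of "vector _"])
  show "lor (?A x) (vector [1, 0, 1]) = lor x (x0 + n)" for x
    by (simp add: lorentz_frame_def lor_def[of "vector _"] lor_simps)
  have t: "lor ?t ?t = 1" using lor_cr_self[OF x0' n(1)] n(2) by simp
  \<comment> \<open>The inverse, reassembling a vector from its frame coordinates.\<close>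
  define B where "B y = y$1 *\<^sub>R x0 + y$2 *\<^sub>R ?t + y$3 *\<^sub>R n" for y :: "real^3"
  have AB: "?A (B y) = y" for y
    using x0' n t by (simp add: lorentz_frame_def B_def vec_eq_iff forall_3 lor_simps lor_commute[of n x0])
  have BA: "B (?A x) = x" for x
    using frame_expand[OF x0' n(1), of x] n(2) by (simp add: lorentz_frame_def B_def algebra_simps)
  have "?A x \<in> H2" if "x \<in> H2" for x
    using iso[of x x] that H2_lor_less(2)[OF x0 H2_lor[OF that]]
    by (simp add: H2_def) (simp add: lorentz_frame_def lor_commute)
  moreover have "B y \<in> H2" if "y \<in> H2" for y
  proof -
    have 1: "lor (B y) (B y) = -1" using iso[of "B y" "B y"] that by (simp add: AB H2_lor)
    have "lor x0 (B y) = - y$1" unfolding B_def using x0' n by (simp add: lor_simps)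
    then show ?thesis using H2_lor_less(2)[OF x0 1] 1 that by (simp add: H2_def)
  qed
  ultimately show "bij_betw ?A H2 H2"
    by (intro bij_betw_byWitness[where f' = B]) (auto simp: AB BA)
qed

section \<open>Implicit equation of \<open>M_half\<close> and coordinates on the two models\<close>

lemma M_half_eq: "M_half = {(x, y). x \<in> H2 \<and> y \<in> H2 \<and> lor x (vector [1, 0, 1]) * lor y (vector [1, 0, 1]) = 1}"
proof -
  define X where "X \<tau> r = cosh \<tau> *\<^sub>R gam r + sinh \<tau> *\<^sub>R Nv r" for \<tau> r
  define Y where "Y \<tau> r = cosh \<tau> *\<^sub>R gam r + sinh \<tau> *\<^sub>R Ntil r" for \<tau> r
  have ch: "cosh \<tau> = (exp \<tau> + exp (- \<tau>)) / 2" "sinh \<tau> = (exp \<tau> - exp (- \<tau>)) / 2" for \<tau> :: real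
    by (simp_all add: cosh_def sinh_def)
  have X: "X \<tau> r = vector [(exp \<tau> + exp (- \<tau>) * (1 + r^2)) / 2, exp (- \<tau>) * r, (exp \<tau> + exp (- \<tau>) * (r^2 - 1)) / 2]" for \<tau> r
    by (simp add: X_def vec_eq_iff forall_3 gam_def Nv_def ch field_simps)
  \<comment> \<open>Passing from \<open>Nv\<close> to \<open>Ntil\<close> reverses \<tau>, so the
    products with the null vector are inverse to each other in the two factors.\<close>
  have Y: "Y \<tau> r = X (- \<tau>) r" for \<tau> r
    unfolding X by (simp add: Y_def vec_eq_iff forall_3 gam_def Ntil_def ch field_simps)
  have XH: "X \<tau> r \<in> H2" for \<tau> r
  proof -
    have "exp \<tau> * exp (- \<tau>) = 1" by (simp add: exp_minus)
    then have "lor (X \<tau> r) (X \<tau> r) = -1"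
      unfolding X lor_def by (simp add: field_simps power2_eq_square)
    moreover have "X \<tau> r $ 1 > 0" unfolding X by (simp add: add_pos_nonneg)
    ultimately show ?thesis by (simp add: H2_def)
  qed
  have Xl: "lor (X \<tau> r) (vector [1, 0, 1]) = - exp (- \<tau>)" for \<tau> r
    unfolding X lor_def by (simp add: field_simps)
  \<comment> \<open>For fixed \<tau> the points form a horocycle; its parameter r is read off from
    the second entry, which is \<open>exp (- \<tau>) * r\<close>.\<close>
  have surj: "\<exists>r. x = X \<tau> r" if x: "x \<in> H2" "lor x (vector [1, 0, 1]) = - exp (- \<tau>)" for x \<tau>
  proof
    define u where "u = exp (- \<tau>)"
    have u: "u > 0" "exp \<tau> = 1 / u" by (simp_all add: u_def exp_minus field_simps)
    have 1: "x$3 = x$1 - u" using x(2) by (simp add: lor_def u_def)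
    have "(x$1)^2 = 1 + (x$2)^2 + (x$3)^2" using x(1) by (auto simp: H2_def lor_def power2_eq_square)
    then have 2: "2 * u * x$1 = 1 + (x$2)^2 + u^2" unfolding 1 by (simp add: power2_eq_square algebra_simps)
    have 3: "x$1 = (1 + (x$2)^2 + u^2) / (2 * u)" using 2 u by (simp add: field_simps)
    show "x = X \<tau> (x$2 / exp (- \<tau>))"
      unfolding X u_def[symmetric] u(2) vec_eq_iff forall_3 using u
      by (simp add: 1 3) (simp add: field_simps power2_eq_square)
  qed
  have M: "M_half = {(X \<tau> r, Y \<tau> s) | \<tau> r s. True}"
  proof -
    have "(X \<tau> r, Y \<tau> s) \<in> M_half" for \<tau> r s
      unfolding M_half_def X_def Y_def by (rule image_eqI[of _ _ "(\<tau> * sqrt 2, r, s)"]) simp_all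
    then show ?thesis unfolding M_half_def X_def Y_def by auto
  qed
  show ?thesis
  proof (rule set_eqI, clarify)
    fix x y
    have "(x, y) \<in> M_half" if xy: "x \<in> H2" "y \<in> H2" "lor x (vector [1, 0, 1]) * lor y (vector [1, 0, 1]) = 1"
    proof -
      have "lor x (vector [1, 0, 1]) < 0"
      proof -
        have "(x$1)^2 = 1 + (x$2)^2 + (x$3)^2" "x$1 > 0" using xy(1) by (auto simp: H2_def lor_def power2_eq_square)
        then have "(x$1)^2 > (x$3)^2" "x$1 > 0" using zero_le_power2[of "x$2"] by linarith+
        then have "x$3 < x$1" using power2_less_imp_less[of "x$3" "x$1"] by simp
        then show ?thesis by (simp add: lor_def)
      qed
      then obtain \<tau> where \<tau>: "lor x (vector [1, 0, 1]) = - exp (- \<tau>)"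
        by (metis exp_ln minus_minus neg_0_less_iff_less)
      have "exp \<tau> * exp (- \<tau>) = 1" by (simp add: exp_minus)
      then have "lor y (vector [1, 0, 1]) = - exp \<tau>"
        using xy(3)[unfolded \<tau>] by algebra
      then have "lor y (vector [1, 0, 1]) = - exp (- (- \<tau>))" by simp
      then show ?thesis using surj[OF xy(1) \<tau>] surj[OF xy(2)] unfolding M Y by blast
    qed
    moreover have "x \<in> H2 \<and> y \<in> H2 \<and> lor x (vector [1, 0, 1]) * lor y (vector [1, 0, 1]) = 1" if "(x, y) \<in> M_half"
      using that unfolding M Y by (auto simp: XH Xl exp_minus)
    ultimately show "(x, y) \<in> M_half \<longleftrightarrow>
       (x, y) \<in> {(x, y). x \<in> H2 \<and> y \<in> H2 \<and> lor x (vector [1, 0, 1]) * lor y (vector [1, 0, 1]) = 1}" by auto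
  qed
qed

lemma continuous_lor [continuous_intros]:
  "continuous_on S f \<Longrightarrow> continuous_on S g \<Longrightarrow> continuous_on S (\<lambda>x. lor (f x) (g x))"
  by (rule lor.continuous_on)

text \<open>Built from axis vectors so that continuity reduces to sums and scalings.\<close>

definition coords3 :: "real \<Rightarrow> real \<Rightarrow> real \<Rightarrow> real^3" where
  "coords3 a b c = a *\<^sub>R axis 1 1 + b *\<^sub>R axis 2 1 + c *\<^sub>R axis 3 1"

lemma coords3_eq_iff: "coords3 a b c = coords3 a' b' c' \<longleftrightarrow> a = a' \<and> b = b' \<and> c = c'"
  by (simp add: coords3_def vec_eq_iff forall_3 axis_def)

lemma M_half_coords:
  defines "\<Theta> \<equiv> \<lambda>z :: pt. coords3 (lor (fst z) (vector [1, 0, 1])) (fst z $ 2) (snd z $ 2)"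
  shows "continuous_on A \<Theta>" "inj_on \<Theta> M_half"
proof -
  show "continuous_on A \<Theta>"
    unfolding \<Theta>_def coords3_def by (intro continuous_intros)
  have eq: "x = x'" if x: "x \<in> H2" "x' \<in> H2" "lor x (vector [1, 0, 1]) = lor x' (vector [1, 0, 1])"
    "lor x (vector [1, 0, 1]) \<noteq> 0" "x$2 = x'$2" for x x'
  proof -
    define u where "u = x$1 - x$3"
    have u: "u \<noteq> 0" "x$1 = x$3 + u" "x'$1 = x'$3 + u" using x by (auto simp: u_def lor_def)
    have "(x$1)^2 = 1 + (x$2)^2 + (x$3)^2" "(x'$1)^2 = 1 + (x'$2)^2 + (x'$3)^2"
      using x(1,2) by (auto simp: H2_def lor_def power2_eq_square)
    \<comment> \<open>With \<open>x$1 = x$3 + u\<close> the squares of \<open>x$3\<close> cancel and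
      a linear equation remains.\<close>
    then have "u * x$3 = u * x'$3" unfolding u(2,3) x(5) by algebra
    then show ?thesis using H2_eqI[OF x(1,2,5)] u(1) by simp
  qed
  show "inj_on \<Theta> M_half"
  proof (rule inj_onI, clarsimp simp: M_half_eq \<Theta>_def coords3_eq_iff)
    fix x y x' y'
    assume h: "x \<in> H2" "y \<in> H2" "x' \<in> H2" "y' \<in> H2" "lor x (vector [1, 0, 1]) = lor x' (vector [1, 0, 1])"
      "lor x' (vector [1, 0, 1]) * lor y (vector [1, 0, 1]) = 1" "lor x' (vector [1, 0, 1]) * lor y' (vector [1, 0, 1]) = 1"
      "x$2 = x'$2" "y$2 = y'$2"
    have "lor x' (vector [1, 0, 1]) \<noteq> 0" "lor y (vector [1, 0, 1]) \<noteq> 0" using h(6) by auto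
    moreover then have "lor y (vector [1, 0, 1]) = lor y' (vector [1, 0, 1])"
      using h(6,7) by (metis mult_left_cancel)
    ultimately show "x = x' \<and> y = y'" using eq[of x x'] eq[of y y'] h by simp
  qed
qed

lemma (in level_curve) M_Gamma_coords:
  "\<exists>W \<Theta>. open W \<and> (x0, y0) \<in> W \<and> continuous_on (M_Gamma \<Gamma> \<inter> W) \<Theta> \<and> inj_on (\<Theta> :: pt \<Rightarrow> real^3) (M_Gamma \<Gamma> \<inter> W)"
proof (intro exI conjI)
  define W :: "pt set" where "W = {z. 0 < 1 + (1 - \<kappa>^2) * (- lor (fst z) x0 - 1)}"
  define \<Theta> where "\<Theta> z = coords3 (lor (fst z) t) (snd z $ 2) (snd z $ 3)" for z :: pt
  show "open W" unfolding W_def by (intro open_Collect_less continuous_intros)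
  show "(x0, y0) \<in> W" unfolding W_def using frame by simp
  show "continuous_on (M_Gamma \<Gamma> \<inter> W) \<Theta>"
    unfolding \<Theta>_def coords3_def by (intro continuous_intros)
  show "inj_on \<Theta> (M_Gamma \<Gamma> \<inter> W)"
    using inj_local unfolding inj_on_def \<Theta>_def coords3_eq_iff M_Gamma_def W_def
    by (auto intro: H2_eqI)
qed

section \<open>From charts to the whole hypersurface\<close>

context
  fixes M :: "pt set" and \<xi> :: "pt \<Rightarrow> pt" and k1 k2 k3 :: real
  assumes hyp: "hypersurface M" and normal: "unit_normal M \<xi>"
    and curv: "principal_curvatures_const M \<xi> k1 k2 k3"
begin

lemma chart_immersed:
  assumes ch: "chart M U f"
  shows "immersed U (\<lambda>u. fst (f u)) (\<lambda>u. snd (f u)) (\<lambda>u. fst (\<xi> (f u))) (\<lambda>u. snd (\<xi> (f u))) k1 k2 k3"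
proof -
  have U: "open U" and f: "Cinf_on U f" and fU: "\<And>u. u \<in> U \<Longrightarrow> f u \<in> M"
    and inj: "\<And>u. u \<in> U \<Longrightarrow> inj (fderiv f u)"
    using ch by (auto simp: chart_def)
  have \<xi>f: "Cinf_on U (\<xi> \<circ> f)" and nor: "\<And>u v. u \<in> U \<Longrightarrow> G (\<xi> (f u)) (fderiv f u v) = 0"
    using normal ch unfolding unit_normal_def by blast+
  have tan: "\<xi> p \<in> tangent_HH p" "G (\<xi> p) (\<xi> p) = 1" if "p \<in> M" for p
    using normal that unfolding unit_normal_def by blast+
  have MH: "M \<subseteq> HH" using hyp by (simp add: hypersurface_def)
  note Df = Cinf_on_has_derivative[OF f U] and D\<xi> = Cinf_on_has_derivative[OF \<xi>f U]
  have d: "fderiv (\<lambda>u. fst (f u)) u X = fst (fderiv f u X)" "fderiv (\<lambda>u. snd (f u)) u X = snd (fderiv f u X)"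
    "fderiv (\<lambda>u. fst (\<xi> (f u))) u X = fst (fderiv (\<xi> \<circ> f) u X)" "fderiv (\<lambda>u. snd (\<xi> (f u))) u X = snd (fderiv (\<xi> \<circ> f) u X)"
    if "u \<in> U" for u X
    using fderiv_eq[OF has_derivative_fst[OF Df[OF that]]] fderiv_eq[OF has_derivative_snd[OF Df[OF that]]]
      fderiv_eq[OF has_derivative_fst[OF D\<xi>[OF that]]] fderiv_eq[OF has_derivative_snd[OF D\<xi>[OF that]]]
    by (simp_all add: o_def)
  show ?thesis
  proof
    show "open U" by (rule U)
    show "Cinf_on U (\<lambda>u. fst (f u))" "Cinf_on U (\<lambda>u. snd (f u))"
      by (rule Cinf_on_bounded_linear_image[OF bounded_linear_fst U order_refl U f] Cinf_on_bounded_linear_image[OF bounded_linear_snd U order_refl U f], simp)+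
    show "Cinf_on U (\<lambda>u. fst (\<xi> (f u)))" "Cinf_on U (\<lambda>u. snd (\<xi> (f u)))"
      by (rule Cinf_on_bounded_linear_image[OF bounded_linear_fst U order_refl U \<xi>f] Cinf_on_bounded_linear_image[OF bounded_linear_snd U order_refl U \<xi>f], simp)+
  next
    fix u assume u: "u \<in> U"
    show "fst (f u) \<in> H2" "snd (f u) \<in> H2" using fU[OF u] MH by (auto simp: HH_def mem_Times_iff)
    show "lor (fst (f u)) (fst (\<xi> (f u))) = 0" "lor (snd (f u)) (snd (\<xi> (f u))) = 0"
      using tan(1)[OF fU[OF u]] by (auto simp: tangent_HH_def)
    show "lor (fst (\<xi> (f u))) (fst (\<xi> (f u))) + lor (snd (\<xi> (f u))) (snd (\<xi> (f u))) = 1"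
      using tan(2)[OF fU[OF u]] by (simp add: G_def)
    show "lor (fst (\<xi> (f u))) (fderiv (\<lambda>u. fst (f u)) u X) + lor (snd (\<xi> (f u))) (fderiv (\<lambda>u. snd (f u)) u X) = 0" for X
      using nor[OF u, of X] by (simp add: d[OF u] G_def)
    have lf: "linear (fderiv f u)" and l\<xi>: "linear (fderiv (\<xi> \<circ> f) u)"
      using linear_fderiv[OF f U u] linear_fderiv[OF \<xi>f U u] .
    show "X = 0" if "fderiv (\<lambda>u. fst (f u)) u X = 0" "fderiv (\<lambda>u. snd (f u)) u X = 0" for X
      using that injD[OF inj[OF u], of X 0] linear_0[OF lf] by (simp add: d[OF u] prod_eq_iff)
    fix X :: "3 \<Rightarrow> real^3" and x :: real
    assume o: "\<And>i j. lor (fderiv (\<lambda>u. fst (f u)) u (X i)) (fderiv (\<lambda>u. fst (f u)) u (X j))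
        + lor (fderiv (\<lambda>u. snd (f u)) u (X i)) (fderiv (\<lambda>u. snd (f u)) u (X j)) = (if i = j then 1 else 0)"
    let ?\<beta> = "\<lambda>X Y. G (fderiv f u X) (fderiv f u Y)"
    let ?\<eta> = "\<lambda>X Y. - G (fderiv (\<xi> \<circ> f) u X) (fderiv f u Y)"
    have "bilinear ?\<beta>" "bilinear ?\<eta>"
      unfolding bilinear_def
      by (auto intro!: linearI simp: G_def linear_add[OF lf] linear_add[OF l\<xi>] linear_scale[OF lf] linear_scale[OF l\<xi>] lor_simps algebra_simps)
    from det_shape_orthonormal[OF this, of X x] o
    have "det (mat x - shape_matrix \<xi> f u) = det (mat x - (\<chi> i j. ?\<eta> (X i) (X j)))"
      by (simp add: d[OF u] G_def shape_matrix_def first_ff_def second_ff_def)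
    moreover have "det (mat x - shape_matrix \<xi> f u) = (x - k1) * (x - k2) * (x - k3)"
      using curv ch u unfolding principal_curvatures_const_def by blast
    ultimately show "det (mat x - (\<chi> i j. - (lor (fderiv (\<lambda>u. fst (\<xi> (f u))) u (X i)) (fderiv (\<lambda>u. fst (f u)) u (X j))
          + lor (fderiv (\<lambda>u. snd (\<xi> (f u))) u (X i)) (fderiv (\<lambda>u. snd (f u)) u (X j))))) = (x - k1) * (x - k2) * (x - k3)"
      by (simp add: d[OF u] G_def)
  qed
qed

end

text \<open>Zero derivative makes \<phi> constant on the chart image of a ball, and that image is
  relatively open in M; connectedness does the rest.\<close>

lemma hypersurface_locally_constant:
  fixes \<phi> :: "pt \<Rightarrow> 'b::real_normed_vector"
  assumes hyp: "hypersurface M" and con: "connected M"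
    and zero: "\<And>U f u. chart M U f \<Longrightarrow> u \<in> U \<Longrightarrow> ((\<lambda>u. \<phi> (f u)) has_derivative (\<lambda>_. 0)) (at u)"
    and xy: "x \<in> M" "y \<in> M"
  shows "\<phi> x = \<phi> y"
proof (rule connected_local_const[OF con xy], safe)
  fix z1 z2 assume "(z1, z2) \<in> M"
  then obtain U f u where ch: "chart M U f" and u: "u \<in> U" "f u = (z1, z2)"
    using hyp unfolding hypersurface_def by fastforce
  obtain g where U: "open U" and g: "homeomorphism U (f ` U) f g" and op: "openin (top_of_set M) (f ` U)"
    using ch unfolding chart_def by blast
  obtain e where e: "e > 0" "ball u e \<subseteq> U" using U u(1) openE by blast
  have "\<exists>c. \<forall>v\<in>ball u e. \<phi> (f v) = c"
    using has_derivative_zero_constant[OF convex_ball, of u e "\<lambda>v. \<phi> (f v)"] zero[OF ch] e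
    by (blast intro: has_derivative_at_withinI)
  then have const: "\<phi> (f v) = \<phi> (z1, z2)" if "v \<in> ball u e" for v
    using that e(1) u(2) by (metis centre_in_ball)
  have "openin (top_of_set U) (ball u e)" using e(2) by (simp add: openin_open_eq U)
  then have "openin (top_of_set (f ` U)) (f ` ball u e)"
    by (rule homeomorphism_imp_open_map[OF g])
  then have "openin (top_of_set M) (f ` ball u e)" using op openin_trans by blast
  then obtain T where T: "open T" "f ` ball u e = M \<inter> T" by (auto simp: openin_open)
  have "(z1, z2) \<in> T" using T(2) u(2) e(1) by (metis IntE centre_in_ball imageI)
  then show "\<forall>\<^sub>F b in at (z1, z2) within M. \<phi> (z1, z2) = \<phi> b"
    unfolding eventually_at_topological using T const by (metis IntI imageE)
qed

lemma hypersurface_openin: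
  assumes hyp: "hypersurface M" and sub: "\<Phi> ` M \<subseteq> T" and \<Phi>: "continuous_on M \<Phi>" "inj_on \<Phi> M"
    and T: "\<And>x. x \<in> \<Phi> ` M \<Longrightarrow> \<exists>W \<Theta>. open W \<and> x \<in> W \<and> continuous_on (T \<inter> W) \<Theta> \<and> inj_on (\<Theta> :: pt \<Rightarrow> real^3) (T \<inter> W)"
  shows "openin (top_of_set T) (\<Phi> ` M)"
proof (rule openin_by_invariance_of_domain[OF sub _ T])
  fix x assume "x \<in> \<Phi> ` M"
  then obtain z where z: "z \<in> M" "x = \<Phi> z" by blast
  then obtain U f where ch: "chart M U f" and zf: "z \<in> f ` U"
    using hyp unfolding hypersurface_def by blast
  obtain g where U: "open U" and fU: "f ` U \<subseteq> M" and g: "homeomorphism U (f ` U) f g"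
    using ch unfolding chart_def by blast
  have "continuous_on U f" "inj_on f U"
    using g by (auto simp: homeomorphism_def intro: inj_on_inverseI)
  then have "continuous_on U (\<Phi> \<circ> f)" "inj_on (\<Phi> \<circ> f) U"
    using continuous_on_compose[of U f \<Phi>] comp_inj_on[of f U \<Phi>] continuous_on_subset[OF \<Phi>(1) fU] inj_on_subset[OF \<Phi>(2) fU]
    by auto
  then show "\<exists>U f. open U \<and> continuous_on U f \<and> inj_on f U \<and> f ` U \<subseteq> \<Phi> ` M \<and> x \<in> f ` (U :: (real^3) set)"
    using U fU zf z by (intro exI[of _ U] exI[of _ "\<Phi> \<circ> f"]) auto
qed

section \<open>Classification\<close>

lemma (in immersed) first_factor_parallel:
  assumes "\<And>u. u \<in> U \<Longrightarrow> n2 u = 0" and u: "u \<in> U"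
  shows "((\<lambda>u. n1 u + (k1 + k2 + k3) *\<^sub>R f1 u) has_derivative (\<lambda>_. 0)) (at u)"
proof -
  have "N1 u X + (k1 + k2 + k3) *\<^sub>R F1 u X = 0" for X
    using first_factor_normal[OF assms, of X] by (simp add: scaleR_left_distrib[symmetric] del: scaleR_left_distrib)
  then show ?thesis
    using has_derivative_add[OF D1(3)[OF u] has_derivative_scaleR_right[OF D1(1)[OF u], of "k1 + k2 + k3"]] by simp
qed

lemma immersed_two_curvatures:
  assumes I: "immersed U f1 f2 n1 n2 a b b" and u: "u \<in> U"
  shows "((\<lambda>u. lor (n1 u) (n1 u)) has_derivative (\<lambda>_. 0)) (at u)"
    and "lor (n1 u) (n1 u) \<in> {0, 1 / 2, 1}"
proof -
  interpret immersed U f1 f2 n1 n2 a b b by (rule I)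
  have cont: "continuous_on U p" "continuous_on U q"
    unfolding p_def q_def using smooth(3,4)[THEN Cinf_on_continuous_on] by (auto intro!: lor.continuous_on)
  \<comment> \<open>The open set to which the nondegenerate analysis applies; off it, p is 0 or
    1.\<close>
  define V where "V = (U \<inter> p -` (- {0})) \<inter> (U \<inter> q -` (- {0}))"
  have V: "open V" "V \<subseteq> U"
    unfolding V_def using continuous_open_preimage[OF cont(1) open_U, of "- {0}"] continuous_open_preimage[OF cont(2) open_U, of "- {0}"]
    by (auto simp: open_Compl)
  interpret R: immersed V f1 f2 n1 n2 a b b by (rule restrict[OF V])
  interpret R: nondegenerate V f1 f2 n1 n2 a b
    by unfold_locales (auto simp: V_def)
  have bounds: "0 \<le> p v" "p v \<le> 1" if "v \<in> U" for v
    using H2_lor_nonneg(1)[OF f_lor(1)[OF that] n_tangent(1)[OF that]]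
      H2_lor_nonneg(1)[OF f_lor(2)[OF that] n_tangent(2)[OF that]] n_unit[OF that] by (auto simp: p_def)
  have q: "q v = 1 - p v" if "v \<in> U" for v using n_unit[OF that] by (simp add: p_def q_def)
  have D: "(p has_derivative (\<lambda>Z. lor (n1 u) (N1 u Z) + lor (N1 u Z) (n1 u))) (at u)"
    unfolding p_def[abs_def] by (rule lor.FDERIV[OF D1(3)[OF u] D1(3)[OF u]])
  show "lor (n1 u) (n1 u) \<in> {0, 1 / 2, 1}"
    using R.normal_form(1)[of u] u q[OF u] by (auto simp: V_def p_def)
  then consider "u \<in> V" | "p u = 0" | "p u = 1" using u q[OF u] by (auto simp: V_def p_def)
  \<comment> \<open>the values 0 and 1 of \<open>p\<close> are extremal, the value 1/2 is taken on an open set\<close>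
  then have "(\<lambda>Z. lor (n1 u) (N1 u Z) + lor (N1 u Z) (n1 u)) = (\<lambda>_. 0)"
  proof cases
    case 1
    have "p v = 1 / 2" if "v \<in> V" for v using R.normal_form(1)[OF that] .
    then show ?thesis using has_derivative_zero_on_open[OF V(1) 1 _ D] by blast
  qed (use differential_zero_maxmin[OF u open_U D] bounds in auto)
  then show "((\<lambda>u. lor (n1 u) (n1 u)) has_derivative (\<lambda>_. 0)) (at u)"
    using D by (simp add: p_def[abs_def])
qed

text \<open>The logarithmic derivatives 2 b tau and - 2 b tau of the two null vectors cancel in the
  product. Pairing with arbitrary y and z expresses that their tensor product is locally
  constant.\<close>

lemma immersed_half:
  assumes I: "immersed U f1 f2 n1 n2 a b b" and half: "\<And>u. u \<in> U \<Longrightarrow> lor (n1 u) (n1 u) = 1 / 2" and u: "u \<in> U"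
  shows "2 * b * b = 1"
    and "((\<lambda>u. lor y (f1 u + (2 * b) *\<^sub>R n1 u) * lor z (f2 u + (2 * b) *\<^sub>R n2 u)) has_derivative (\<lambda>_. 0)) (at u)"
proof -
  interpret immersed U f1 f2 n1 n2 a b b by (rule I)
  interpret nondegenerate U f1 f2 n1 n2 a b
    by unfold_locales (use half n_unit in \<open>force simp: p_def q_def\<close>)+
  show b: "2 * b * b = 1" by (rule normal_form(2)[OF u])
  define \<nu>1 where "\<nu>1 = f1 u + (2 * b) *\<^sub>R n1 u"
  define \<nu>2 where "\<nu>2 = f2 u + (2 * b) *\<^sub>R n2 u"
  have N: "F1 u X + (2 * b) *\<^sub>R N1 u X = (2 * b * tau u X) *\<^sub>R \<nu>1"
    "F2 u X + (2 * b) *\<^sub>R N2 u X = (- 2 * b * tau u X) *\<^sub>R \<nu>2" for X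
  proof -
    have bb: "(2 * b) *\<^sub>R (- b *\<^sub>R w) = - w" for w :: "real^3" using b by simp
    show "F1 u X + (2 * b) *\<^sub>R N1 u X = (2 * b * tau u X) *\<^sub>R \<nu>1"
      unfolding normal_form(3)[OF u] \<nu>1_def[symmetric] scaleR_right_distrib[of "2 * b"] bb by simp
    show "F2 u X + (2 * b) *\<^sub>R N2 u X = (- 2 * b * tau u X) *\<^sub>R \<nu>2"
      unfolding normal_form(4)[OF u] \<nu>2_def[symmetric] scaleR_right_diff_distrib[of "2 * b"] bb by simp
  qed
  have "((\<lambda>u. lor y (f1 u + (2 * b) *\<^sub>R n1 u) * lor z (f2 u + (2 * b) *\<^sub>R n2 u)) has_derivative
    (\<lambda>X. lor y \<nu>1 * lor z (F2 u X + (2 * b) *\<^sub>R N2 u X) + lor y (F1 u X + (2 * b) *\<^sub>R N1 u X) * lor z \<nu>2)) (at u)"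
    unfolding \<nu>1_def \<nu>2_def
    by (intro has_derivative_mult bounded_linear.has_derivative[OF lor.bounded_linear_right]
        has_derivative_add has_derivative_scaleR_right D1[OF u])
  then show "((\<lambda>u. lor y (f1 u + (2 * b) *\<^sub>R n1 u) * lor z (f2 u + (2 * b) *\<^sub>R n2 u)) has_derivative (\<lambda>_. 0)) (at u)"
    unfolding N by (simp add: lor_simps)
qed

text \<open>Serves both degenerate cases: \<Phi> is the identity or the exchange of factors, and m
  the nonzero component of the normal. The products of the constant vector c follow from m being a
  unit vector orthogonal to the first component.\<close>

lemma hypersurface_in_cylinder:
  assumes hyp: "hypersurface M" and con: "connected M"
    and \<Phi>: "continuous_on M \<Phi>" "inj_on \<Phi> M" "\<Phi> ` M \<subseteq> HH"
    and m: "\<And>x. x \<in> M \<Longrightarrow> lor (fst (\<Phi> x)) (m x) = 0" "\<And>x. x \<in> M \<Longrightarrow> lor (m x) (m x) = 1"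
    and zero: "\<And>U f u. chart M U f \<Longrightarrow> u \<in> U \<Longrightarrow>
      ((\<lambda>u. m (f u) + \<kappa> *\<^sub>R fst (\<Phi> (f u))) has_derivative (\<lambda>_. 0)) (at u)"
    and ne: "x0 \<in> M"
  shows "\<exists>\<Gamma>. const_curv_curve \<Gamma> \<and> \<Phi> ` M \<subseteq> M_Gamma \<Gamma> \<and> openin (top_of_set (M_Gamma \<Gamma>)) (\<Phi> ` M)"
proof -
  define c where "c = m x0 + \<kappa> *\<^sub>R fst (\<Phi> x0)"
  have c: "m x + \<kappa> *\<^sub>R fst (\<Phi> x) = c" if "x \<in> M" for x
    unfolding c_def
    by (rule hypersurface_locally_constant[OF hyp con _ that ne, where \<phi> = "\<lambda>x. m x + \<kappa> *\<^sub>R fst (\<Phi> x)"]) (rule zero)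
  have lev: "level_curve (fst (\<Phi> x)) c \<kappa>" if x: "x \<in> M" for x
  proof
    have H: "fst (\<Phi> x) \<in> H2" using \<Phi>(3) x by (auto simp: HH_def)
    then show "fst (\<Phi> x) \<in> H2" .
    show "lor (fst (\<Phi> x)) c = - \<kappa>" "lor c c = 1 - \<kappa>\<^sup>2"
      unfolding c[OF x, symmetric] using m[OF x] H2_lor[OF H]
      by (simp_all add: lor_simps lor_commute[of "m x" "fst (\<Phi> x)"] power2_eq_square)
  qed
  \<comment> \<open>The level curve depends on c and \<kappa> only, so every point of M can serve as
    base point of the same curve.\<close>
  define \<Gamma> where "\<Gamma> = level_curve.\<Gamma> c \<kappa>"
  have sub: "\<Phi> ` M \<subseteq> M_Gamma \<Gamma>"
  proof
    fix z assume "z \<in> \<Phi> ` M"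
    then obtain x where x: "x \<in> M" "z = \<Phi> x" by blast
    then have "fst z \<in> \<Gamma>" unfolding \<Gamma>_def level_curve.\<Gamma>_def[OF lev[OF x(1)]]
      using level_curve.x0[OF lev[OF x(1)]] by simp
    moreover have "snd z \<in> H2" using \<Phi>(3) x by (auto simp: HH_def)
    ultimately show "z \<in> M_Gamma \<Gamma>" by (cases z) (simp add: M_Gamma_def)
  qed
  have "openin (top_of_set (M_Gamma \<Gamma>)) (\<Phi> ` M)"
  proof (rule hypersurface_openin[OF hyp sub \<Phi>(1,2)])
    fix z assume "z \<in> \<Phi> ` M"
    then obtain x where x: "x \<in> M" "z = (fst (\<Phi> x), snd (\<Phi> x))" by auto
    show "\<exists>W \<Theta>. open W \<and> z \<in> W \<and> continuous_on (M_Gamma \<Gamma> \<inter> W) \<Theta> \<and> inj_on (\<Theta> :: pt \<Rightarrow> real^3) (M_Gamma \<Gamma> \<inter> W)"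
      unfolding x(2) \<Gamma>_def by (rule level_curve.M_Gamma_coords[OF lev[OF x(1)]])
  qed
  then show ?thesis using sub level_curve.const_curv[OF lev[OF ne]] unfolding \<Gamma>_def by blast
qed

lemma hypersurface_in_M_half:
  assumes hyp: "hypersurface M" and sub: "M \<subseteq> HH"
    and x0: "x1 \<in> H2" "x2 \<in> H2" and m: "lor x1 m1 = 0" "lor m1 m1 = 1" "lor x2 m2 = 0" "lor m2 m2 = 1"
    and eq: "\<And>x. x \<in> M \<Longrightarrow> lor (fst x) (x1 + m1) * lor (snd x) (x2 + m2) = 1"
  shows "\<exists>\<Phi>. isometry_HH \<Phi> \<and> \<Phi> ` M \<subseteq> M_half \<and> openin (top_of_set M_half) (\<Phi> ` M)"
proof -
  define A where "A = lorentz_frame x1 m1"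
  define B where "B = lorentz_frame x2 m2"
  note A = lorentz_frame[OF x0(1) m(1,2), folded A_def] and B = lorentz_frame[OF x0(2) m(3,4), folded B_def]
  define \<Phi> where "\<Phi> = map_prod A B"
  have bij: "bij_betw \<Phi> HH HH"
    unfolding \<Phi>_def HH_def by (rule bij_betw_map_prod[OF A(3) B(3)])
  have lin: "linear \<Phi>"
    by (rule linearI) (auto simp: \<Phi>_def linear_add[OF A(1)] linear_add[OF B(1)] linear_scale[OF A(1)] linear_scale[OF B(1)])
  have iso: "isometry_HH \<Phi>"
    by (rule isometry_HH_linear[OF lin bij]) (auto simp: \<Phi>_def G_def A(2) B(2))
  have half: "\<Phi> ` M \<subseteq> M_half"
  proof
    fix z assume "z \<in> \<Phi> ` M"
    then obtain x where x: "x \<in> M" "z = (A (fst x), B (snd x))" by (auto simp: \<Phi>_def)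
    have "fst x \<in> H2" "snd x \<in> H2" using x(1) sub by (auto simp: HH_def)
    then show "z \<in> M_half"
      unfolding M_half_eq x(2) using eq[OF x(1)] A(3,4) B(3,4) by (auto simp: bij_betw_def)
  qed
  have "openin (top_of_set M_half) (\<Phi> ` M)"
  proof (rule hypersurface_openin[OF hyp half])
    show "continuous_on M \<Phi>" using lin linear_continuous_on linear_conv_bounded_linear by blast
    show "inj_on \<Phi> M" using bij sub by (meson bij_betw_def inj_on_subset)
  qed (use M_half_coords in \<open>blast intro: inj_on_subset\<close>)
  then show ?thesis using iso half by blast
qed

lemma two_curvatures:
  fixes k1 k2 k3 :: real
  assumes "card {k1, k2, k3} \<le> 2"
  obtains a b where "\<And>x. (x - k1) * (x - k2) * (x - k3) = (x - a) * (x - b) * (x - b)"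
proof -
  have "k1 = k2 \<or> k1 = k3 \<or> k2 = k3"
    using assms by (auto simp: card_insert_if split: if_splits)
  then show ?thesis
    by (elim disjE) (rule that[of k3 k1] that[of k2 k1] that[of k1 k2]; simp add: algebra_simps)+
qed

theorem theorem1p3:
  fixes M :: "pt set" and \<xi> :: "pt \<Rightarrow> pt" and k1 k2 k3 :: real
  assumes "hypersurface M"
    and "connected M"
    and "unit_normal M \<xi>"
    and "principal_curvatures_const M \<xi> k1 k2 k3"
    and "card {k1, k2, k3} \<le> 2"
  shows "\<exists>\<Phi>. isometry_HH \<Phi> \<and>
           ((\<exists>\<Gamma>. const_curv_curve \<Gamma> \<and> \<Phi> ` M \<subseteq> M_Gamma \<Gamma>
                 \<and> openin (top_of_set (M_Gamma \<Gamma>)) (\<Phi> ` M))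
            \<or> (\<Phi> ` M \<subseteq> M_half \<and> openin (top_of_set M_half) (\<Phi> ` M)))"
proof -
  have id: "isometry_HH id"
    by (rule isometry_HH_linear) (auto intro: linear_id simp: bij_betw_id)
  have MH: "M \<subseteq> HH" using assms(1) by (simp add: hypersurface_def)
  obtain a b where "\<And>x. (x - k1) * (x - k2) * (x - k3) = (x - a) * (x - b) * (x - b)"
    using two_curvatures[OF assms(5)] by blast
  then have curv: "principal_curvatures_const M \<xi> a b b"
    using assms(4) by (simp add: principal_curvatures_const_def)
  note imm = chart_immersed[OF assms(1,3) curv]
  have tan: "lor (fst x) (fst (\<xi> x)) = 0" "lor (snd x) (snd (\<xi> x)) = 0"
    "lor (fst (\<xi> x)) (fst (\<xi> x)) + lor (snd (\<xi> x)) (snd (\<xi> x)) = 1" if "x \<in> M" for x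
    using assms(3) that unfolding unit_normal_def tangent_HH_def G_def by blast+
  have H: "fst x \<in> H2" "snd x \<in> H2" if "x \<in> M" for x using MH that by (auto simp: HH_def)
  define P where "P x = lor (fst (\<xi> x)) (fst (\<xi> x))" for x
  show ?thesis
  proof (cases "M = {}")
    case True
    \<comment> \<open>The empty hypersurface is an open part of any cylinder; a geodesic provides
      one.\<close>
    have "level_curve (vector [1, 0, 0]) (vector [0, 1, 0]) 0"
      by unfold_locales (simp_all add: H2_def lor_def)
    from level_curve.const_curv[OF this] show ?thesis using id True by auto
  next
    case False
    then obtain x0 where x0: "x0 \<in> M" by blast
    have const: "P x = P x0" if "x \<in> M" for x
      by (rule hypersurface_locally_constant[OF assms(1,2) _ that x0])
        (unfold P_def, rule immersed_two_curvatures(1)[OF imm])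
    obtain U f u where ch0: "chart M U f" and u0: "u \<in> U" "x0 = f u"
      using assms(1) x0 unfolding hypersurface_def by blast
    have inM: "f u \<in> M" if "chart M U f" "u \<in> U" for U f u using that by (auto simp: chart_def)
    consider "P x0 = 1" | "P x0 = 0" | "P x0 = 1 / 2"
      using immersed_two_curvatures(2)[OF imm[OF ch0] u0(1)] u0(2) by (auto simp: P_def)
    then show ?thesis
    proof cases
      case 1
      \<comment> \<open>All of the unit length sits in the first component, and tangent vectors of
        square zero vanish.\<close>
      have n2: "snd (\<xi> x) = 0" if "x \<in> M" for x
        using H2_lor_nonneg(2)[OF H2_lor[OF H(2)[OF that]] tan(2)[OF that]] tan(3)[OF that] const[OF that] 1
        by (simp add: P_def)
      have "\<exists>\<Gamma>. const_curv_curve \<Gamma> \<and> id ` M \<subseteq> M_Gamma \<Gamma> \<and> openin (top_of_set (M_Gamma \<Gamma>)) (id ` M)"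
      proof (rule hypersurface_in_cylinder[OF assms(1,2) _ _ _ _ _ _ x0, where m = "\<lambda>x. fst (\<xi> x)" and \<kappa> = "a + b + b"])
        fix U f u assume ch: "chart M U f" and u: "u \<in> U"
        show "((\<lambda>u. fst (\<xi> (f u)) + (a + b + b) *\<^sub>R fst (id (f u))) has_derivative (\<lambda>_. 0)) (at u)"
          unfolding id_apply by (rule immersed.first_factor_parallel[OF imm[OF ch] n2[OF inM[OF ch]] u])
      qed (use tan const 1 MH in \<open>auto simp: P_def\<close>)
      then show ?thesis using id by blast
    next
      case 2
      have n1: "fst (\<xi> x) = 0" if "x \<in> M" for x
        using H2_lor_nonneg(2)[OF H2_lor[OF H(1)[OF that]] tan(1)[OF that]] const[OF that] 2
        by (simp add: P_def)
      \<comment> \<open>Exchanging the factors reduces to the previous case.\<close>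
      have "\<exists>\<Gamma>. const_curv_curve \<Gamma> \<and> prod.swap ` M \<subseteq> M_Gamma \<Gamma> \<and> openin (top_of_set (M_Gamma \<Gamma>)) (prod.swap ` M)"
      proof (rule hypersurface_in_cylinder[OF assms(1,2) _ _ _ _ _ _ x0, where m = "\<lambda>x. snd (\<xi> x)" and \<kappa> = "a + b + b"])
        fix U f u assume ch: "chart M U f" and u: "u \<in> U"
        show "((\<lambda>u. snd (\<xi> (f u)) + (a + b + b) *\<^sub>R fst (prod.swap (f u))) has_derivative (\<lambda>_. 0)) (at u)"
          unfolding fst_swap
          by (rule immersed.first_factor_parallel[OF immersed.swapped[OF imm[OF ch]] n1[OF inM[OF ch]] u])
      next
        show "continuous_on M prod.swap" by (simp add: prod.swap_def[abs_def] continuous_intros)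
      qed (use tan n1 MH in \<open>auto simp: HH_def lor_simps\<close>)
      then show ?thesis using isometry_HH_swap by blast
    next
      case 3
      have half: "lor (fst (\<xi> (f u))) (fst (\<xi> (f u))) = 1 / 2" if "chart M U f" "u \<in> U" for U f u
        using const[OF inM[OF that]] 3 by (simp add: P_def)
      note hf = immersed_half[OF imm half]
      have b: "2 * b * b = 1" using hf(1)[OF ch0 ch0 _ u0(1)] by blast
      define \<nu>1 where "\<nu>1 x = fst x + (2 * b) *\<^sub>R fst (\<xi> x)" for x
      define \<nu>2 where "\<nu>2 x = snd x + (2 * b) *\<^sub>R snd (\<xi> x)" for x
      have cst: "lor y (\<nu>1 x) * lor z (\<nu>2 x) = lor y (\<nu>1 x0) * lor z (\<nu>2 x0)" if "x \<in> M" for x y z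
      proof (rule hypersurface_locally_constant[OF assms(1,2) _ that x0])
        fix U f u assume ch: "chart M U f" "u \<in> U"
        show "((\<lambda>u. lor y (\<nu>1 (f u)) * lor z (\<nu>2 (f u))) has_derivative (\<lambda>_. 0)) (at u)"
          unfolding \<nu>1_def \<nu>2_def by (rule hf(2)[OF ch(1) ch(1) _ ch(2)])
      qed
      have four: "(2 * b) * (2 * b) = 2" using b by (simp add: algebra_simps)
      have "\<exists>\<Phi>. isometry_HH \<Phi> \<and> \<Phi> ` M \<subseteq> M_half \<and> openin (top_of_set M_half) (\<Phi> ` M)"
      proof (rule hypersurface_in_M_half[OF assms(1) MH H[OF x0]])
        show "lor (fst x0) ((2 * b) *\<^sub>R fst (\<xi> x0)) = 0" "lor (snd x0) ((2 * b) *\<^sub>R snd (\<xi> x0)) = 0"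
          using tan[OF x0] by (simp_all add: lor_simps)
        \<comment> \<open>Each component of the normal has square 1/2 and
          \<open>(2 * b)^2 = 2\<close>, so scaling by 2 b makes it a unit vector.\<close>
        have "lor ((2 * b) *\<^sub>R v) ((2 * b) *\<^sub>R v) = 2 * lor v v" for v
          using four by (simp add: lor_simps)
        then show "lor ((2 * b) *\<^sub>R fst (\<xi> x0)) ((2 * b) *\<^sub>R fst (\<xi> x0)) = 1"
          "lor ((2 * b) *\<^sub>R snd (\<xi> x0)) ((2 * b) *\<^sub>R snd (\<xi> x0)) = 1"
          using 3 tan(3)[OF x0] by (simp_all add: P_def)
      next
        fix x assume x: "x \<in> M"
        \<comment> \<open>At x itself the two products multiply to 1; constancy of the tensor
          product replaces the null vectors at x by those at \<open>x0\<close>.\<close>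
        have "lor (fst x) (\<nu>1 x) = -1" "lor (snd x) (\<nu>2 x) = -1"
          unfolding \<nu>1_def \<nu>2_def using tan[OF x] H[OF x] by (simp_all add: lor_simps H2_lor)
        then show "lor (fst x) (fst x0 + (2 * b) *\<^sub>R fst (\<xi> x0)) * lor (snd x) (snd x0 + (2 * b) *\<^sub>R snd (\<xi> x0)) = 1"
          using cst[OF x, of "fst x" "snd x"] unfolding \<nu>1_def \<nu>2_def by simp
      qed
      then show ?thesis by blast
    qed
  qed
qed

end
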